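(* Let $B$ be a left semi-brace such that $(G,+)$ is a finite nilpotent group and $(E,\circ)$ is a nilpotent group contained in the centralizer of $G$ in $(B,\circ)$. Then $B$ is left nilpotent if and only if the multiplicative group $(B,\circ)$ of $B$ is nilpotent.
   Context: A left semi-brace is a set $B$ with two operations $+$ and $\circ$ such that $(B,+)$ is a left cancellative semigroup (not necessarily commutative), $(B,\circ)$ is a group, and $a\circ(b+c)=a\circ b+a\circ(a^-+c)$ for all $a,b,c\in B$, where $a^-$ is the inverse of $a$ in $(B,\circ)$ and $\circ$ has higher precedence than $+$. The identity of $(B,\circ)$ is denoted $0$; it is an idempotent and a left identity of $(B,+)$. Let $E$ be the set of idempotents of $(B,+)$, which is a subgroup of $(B,\circ)$, and $G=B+0=\{b+0: b\in B\}$, which is a subgroup of $(B,+)$ (with identity $0$). For $a,b\in B$ put $\lambda_a(b)=a\circ(a^-+b)$ and define the operation $a\cdot b=\lambda_a(a^-)+a\circ b+\lambda_b(b^-)$; one has $a\cdot b\in G$. For subsets $X,Y\subseteq B$, $X\cdot Y$ denotes the subgroup of $(G,+)$ generated by all $x\cdot y$ with $x\in X$, $y\in Y$, and $X+Y=\{x+y:x\in X,y\in Y\}$. The left series of $B$ is $B^1=B$, $B^{n+1}=B\cdot B^n+E$ for $n\ge1$; $B$ is left nilpotent if $B^n=E$ for some positive integer $n$. *)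

theory Defs
  imports "HOL-Algebra.Generated_Groups"
begin

primrec lower_central_series :: "('a, 'b) monoid_scheme \<Rightarrow> nat \<Rightarrow> 'a set" where
  "lower_central_series G 0 = carrier G"
| "lower_central_series G (Suc n) =
     generate G {x \<otimes>\<^bsub>G\<^esub> g \<otimes>\<^bsub>G\<^esub> inv\<^bsub>G\<^esub> x \<otimes>\<^bsub>G\<^esub> inv\<^bsub>G\<^esub> g | x g.
       x \<in> lower_central_series G n \<and> g \<in> carrier G}"

definition nilpotent_group :: "('a, 'b) monoid_scheme \<Rightarrow> bool" where
  "nilpotent_group G \<longleftrightarrow> group G \<and> (\<exists>n. lower_central_series G n = {\<one>\<^bsub>G\<^esub>})"

definition centralizer :: "('a, 'b) monoid_scheme \<Rightarrow> 'a set \<Rightarrow> 'a set" where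
  "centralizer G S = {x \<in> carrier G. \<forall>s\<in>S. x \<otimes>\<^bsub>G\<^esub> s = s \<otimes>\<^bsub>G\<^esub> x}"

text \<open>
  The monoid part of the record is the multiplicative group, so \<open>\<otimes>\<close> is the circle operation and
  \<open>\<one>\<close> is its identity, usually written \<open>0\<close> because it is a left identity of the addition.
  The addition is written \<open>\<boxplus>\<close>.
\<close>

record 'a semi_brace = "'a monoid" +
  plus :: "'a \<Rightarrow> 'a \<Rightarrow> 'a" (infixl \<open>\<boxplus>\<index>\<close> 65)

locale left_semi_brace = group B for B :: "('a, 'b) semi_brace_scheme" (structure) +
  assumes plus_closed: "\<lbrakk>a \<in> carrier B; b \<in> carrier B\<rbrakk> \<Longrightarrow> a \<boxplus> b \<in> carrier B"
    and plus_assoc: "\<lbrakk>a \<in> carrier B; b \<in> carrier B; c \<in> carrier B\<rbrakk>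
      \<Longrightarrow> a \<boxplus> b \<boxplus> c = a \<boxplus> (b \<boxplus> c)"
    and plus_left_cancel: "\<lbrakk>a \<in> carrier B; b \<in> carrier B; c \<in> carrier B; a \<boxplus> b = a \<boxplus> c\<rbrakk>
      \<Longrightarrow> b = c"
    and mult_plus: "\<lbrakk>a \<in> carrier B; b \<in> carrier B; c \<in> carrier B\<rbrakk>
      \<Longrightarrow> a \<otimes> (b \<boxplus> c) = (a \<otimes> b) \<boxplus> (a \<otimes> (inv a \<boxplus> c))"

definition idempotents :: "('a, 'b) semi_brace_scheme \<Rightarrow> 'a set" where
  "idempotents B = {e \<in> carrier B. e \<boxplus>\<^bsub>B\<^esub> e = e}"

definition mult_idempotents :: "('a, 'b) semi_brace_scheme \<Rightarrow> 'a monoid" where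
  "mult_idempotents B = \<lparr>carrier = idempotents B, mult = mult B, one = \<one>\<^bsub>B\<^esub>\<rparr>"

definition additive_part :: "('a, 'b) semi_brace_scheme \<Rightarrow> 'a set" where
  "additive_part B = {b \<boxplus>\<^bsub>B\<^esub> \<one>\<^bsub>B\<^esub> | b. b \<in> carrier B}"

definition additive_group :: "('a, 'b) semi_brace_scheme \<Rightarrow> 'a monoid" where
  "additive_group B = \<lparr>carrier = additive_part B, mult = plus B, one = \<one>\<^bsub>B\<^esub>\<rparr>"

definition lambda :: "('a, 'b) semi_brace_scheme \<Rightarrow> 'a \<Rightarrow> 'a \<Rightarrow> 'a" where
  "lambda B a b = a \<otimes>\<^bsub>B\<^esub> (inv\<^bsub>B\<^esub> a \<boxplus>\<^bsub>B\<^esub> b)"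

definition dot :: "('a, 'b) semi_brace_scheme \<Rightarrow> 'a \<Rightarrow> 'a \<Rightarrow> 'a" where
  "dot B a b =
     lambda B a (inv\<^bsub>B\<^esub> a) \<boxplus>\<^bsub>B\<^esub> (a \<otimes>\<^bsub>B\<^esub> b) \<boxplus>\<^bsub>B\<^esub> lambda B b (inv\<^bsub>B\<^esub> b)"

definition dot_set :: "('a, 'b) semi_brace_scheme \<Rightarrow> 'a set \<Rightarrow> 'a set \<Rightarrow> 'a set" where
  "dot_set B X Y = generate (additive_group B) {dot B x y | x y. x \<in> X \<and> y \<in> Y}"

definition plus_set :: "('a, 'b) semi_brace_scheme \<Rightarrow> 'a set \<Rightarrow> 'a set \<Rightarrow> 'a set" where
  "plus_set B X Y = {x \<boxplus>\<^bsub>B\<^esub> y | x y. x \<in> X \<and> y \<in> Y}"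

text \<open>
  Indices are shifted by one: \<open>left_series B n\<close> is the term \<open>B\<^sup>n\<^sup>+\<^sup>1\<close> of the left series, which is
  conventionally numbered from \<open>B\<^sup>1 = B\<close>.
\<close>

primrec left_series :: "('a, 'b) semi_brace_scheme \<Rightarrow> nat \<Rightarrow> 'a set" where
  "left_series B 0 = carrier B"
| "left_series B (Suc n) =
     plus_set B (dot_set B (carrier B) (left_series B n)) (idempotents B)"

definition left_nilpotent :: "('a, 'b) semi_brace_scheme \<Rightarrow> bool" where
  "left_nilpotent B \<longleftrightarrow> (\<exists>n. left_series B n = idempotents B)"

end

theory Submission
  imports Defs "HOL-Algebra.Sylow" "HOL-Algebra.Group_Action" "HOL-Algebra.Multiplicative_Group"
begin

text \<open>
  The argument reduces to a skew left brace. The additive part \<open>G\<close> is the stabiliser of the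
  identity under the action \<open>lambda\<close> of the multiplicative group, so it is a multiplicative subgroup,
  and every element of \<open>B\<close> is an idempotent times an element of \<open>G\<close>. Since the idempotents \<open>E\<close>
  commute with \<open>G\<close>, the multiplicative group is an image of the direct product of \<open>E\<close> and \<open>G\<close>, and it
  is nilpotent exactly if its subgroup \<open>G\<close> is (\<open>nilpotent_group_iff\<close>). Moreover \<open>E\<close> contributes nothing
  to the dot products, and the left series is the sum of \<open>E\<close> and of the series
  \<open>D\<^sub>0 = G\<close>, \<open>D\<^sub>n\<^sub>+\<^sub>1 = \<langle>lambda h x - x. h \<in> G, x \<in> D\<^sub>n\<rangle>\<close> (\<open>left_series_eq\<close>). It
  remains to show, for the finite skew left brace \<open>G\<close> with nilpotent additive group \<open>A\<close> and circle
  group \<open>H\<close>, that some \<open>D\<^sub>n\<close> is trivial if and only if \<open>H\<close> is nilpotent.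

  Both conditions are equivalent to a third one. Let the semidirect product of \<open>A\<close> and \<open>H\<close> act on
  \<open>A\<close>, and let \<open>F\<^sub>0 = 0\<close> and \<open>F\<^sub>n\<^sub>+\<^sub>1\<close> consist of the elements fixed modulo \<open>F\<^sub>n\<close>. The
  third condition is that this ascending series reaches \<open>A\<close>; as \<open>A\<close> is finite, it suffices for this that the
  series grows strictly as long as it has not reached \<open>A\<close>. So let \<open>F\<close> be a proper subgroup in the series
  and \<open>Z / F\<close> the centre of \<open>A / F\<close>, which is not trivial because \<open>A\<close> is nilpotent. What is needed is an
  element of \<open>Z\<close> outside \<open>F\<close> that \<open>H\<close> fixes modulo \<open>F\<close>.

  If some \<open>D\<^sub>n\<close> is trivial, iterating \<open>x \<mapsto> lambda h x - x\<close> on \<open>Z\<close> ends in \<open>F\<close>, and the elements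
  outside \<open>F\<close> in the last step before that are fixed modulo \<open>F\<close>.

  If \<open>H\<close> is nilpotent, let \<open>A\<^sub>p\<close> be the \<open>p\<close>-primary component of \<open>A\<close>. It is invariant under the action,
  hence a subgroup of \<open>H\<close> of the same order. For \<open>p \<noteq> q\<close> elements \<open>a \<in> A\<^sub>p\<close> and \<open>b \<in> A\<^sub>q\<close> have
  coprime orders in both nilpotent groups and commute in both, which forces \<open>b\<close> to fix \<open>a\<close>
  (\<open>p_torsion_act_trivial\<close>). Choose \<open>p\<close> such that \<open>Z \<inter> A\<^sub>p\<close> is not contained in \<open>F\<close>. The \<open>p\<close>-group
  \<open>A\<^sub>p\<close> fixes some \<open>y \<in> Z \<inter> A\<^sub>p\<close> outside \<open>F\<close> modulo \<open>F\<close> (\<open>p_group_fixed_coset\<close>), and every other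
  \<open>A\<^sub>q\<close> fixes \<open>y\<close>. The stabiliser of \<open>y\<close> modulo \<open>F\<close> in \<open>H\<close> contains a subgroup of full prime power
  order for every prime, so it is \<open>H\<close>.

  Conversely let the ascending series reach \<open>A\<close>. Then \<open>D\<^sub>n\<close> is trivial for large \<open>n\<close> by definition. The
  \<open>i\<close>-th term of the lower central series of \<open>H\<close> maps \<open>F\<^sub>i\<^sub>+\<^sub>j\<close> into \<open>F\<^sub>j\<close> (in the sense of
  \<open>x \<mapsto> lambda h x - x\<close>), so a late term lies in the kernel of the action. On this kernel the two
  group operations agree, and from there on the lower central series descends along \<open>F\<close>
  (\<open>circ_lower_central_series_kernel\<close>). Hence \<open>H\<close> is nilpotent.
\<close>

section \<open>Lower central series\<close>

lemma (in group) inv_mult_cancel: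
  assumes "x \<in> carrier G" "y \<in> carrier G"
  shows "inv x \<otimes> (x \<otimes> y) = y" and "x \<otimes> (inv x \<otimes> y) = y"
  using assms by (simp_all flip: m_assoc)

lemma lower_central_series_normal:
  assumes "group G"
  shows "lower_central_series G n \<lhd> G"
proof (induction n)
  case 0
  interpret group G by fact
  show ?case by (simp add: normal_inv_iff subgroup_self)
next
  case (Suc n)
  interpret group G by fact
  interpret N: normal "lower_central_series G n" G by (rule Suc)
  have conj: "a \<otimes>\<^bsub>G\<^esub> (x \<otimes>\<^bsub>G\<^esub> g \<otimes>\<^bsub>G\<^esub> inv\<^bsub>G\<^esub> x \<otimes>\<^bsub>G\<^esub> inv\<^bsub>G\<^esub> g) \<otimes>\<^bsub>G\<^esub> inv\<^bsub>G\<^esub> a =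
      (a \<otimes>\<^bsub>G\<^esub> x \<otimes>\<^bsub>G\<^esub> inv\<^bsub>G\<^esub> a) \<otimes>\<^bsub>G\<^esub> (a \<otimes>\<^bsub>G\<^esub> g \<otimes>\<^bsub>G\<^esub> inv\<^bsub>G\<^esub> a) \<otimes>\<^bsub>G\<^esub>
      inv\<^bsub>G\<^esub> (a \<otimes>\<^bsub>G\<^esub> x \<otimes>\<^bsub>G\<^esub> inv\<^bsub>G\<^esub> a) \<otimes>\<^bsub>G\<^esub> inv\<^bsub>G\<^esub> (a \<otimes>\<^bsub>G\<^esub> g \<otimes>\<^bsub>G\<^esub> inv\<^bsub>G\<^esub> a)"
    if "a \<in> carrier G" "x \<in> carrier G" "g \<in> carrier G" for a x g
    using that by (simp add: m_assoc inv_mult_group inv_mult_cancel)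
  show ?case
    unfolding lower_central_series.simps
  proof (rule normal_generateI)
    fix h a
    assume "h \<in> {x \<otimes>\<^bsub>G\<^esub> g \<otimes>\<^bsub>G\<^esub> inv\<^bsub>G\<^esub> x \<otimes>\<^bsub>G\<^esub> inv\<^bsub>G\<^esub> g | x g.
        x \<in> lower_central_series G n \<and> g \<in> carrier G}" and a: "a \<in> carrier G"
    then obtain x g where x: "x \<in> lower_central_series G n" and g: "g \<in> carrier G"
      and h: "h = x \<otimes>\<^bsub>G\<^esub> g \<otimes>\<^bsub>G\<^esub> inv\<^bsub>G\<^esub> x \<otimes>\<^bsub>G\<^esub> inv\<^bsub>G\<^esub> g" by auto
    have "a \<otimes>\<^bsub>G\<^esub> x \<otimes>\<^bsub>G\<^esub> inv\<^bsub>G\<^esub> a \<in> lower_central_series G n"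
      using N.inv_op_closed2 a x by blast
    then show "a \<otimes>\<^bsub>G\<^esub> h \<otimes>\<^bsub>G\<^esub> inv\<^bsub>G\<^esub> a \<in> {x \<otimes>\<^bsub>G\<^esub> g \<otimes>\<^bsub>G\<^esub> inv\<^bsub>G\<^esub> x \<otimes>\<^bsub>G\<^esub> inv\<^bsub>G\<^esub> g | x g.
        x \<in> lower_central_series G n \<and> g \<in> carrier G}"
      unfolding h using conj[OF a _ g, of x] N.mem_carrier[OF x] a g by blast
  qed (use N.mem_carrier in auto)
qed

lemma lower_central_series_subgroup:
  assumes "group G"
  shows "subgroup (lower_central_series G n) G"
  using lower_central_series_normal[OF assms] normal_imp_subgroup by blast

lemma lower_central_series_commutator:
  assumes "x \<in> lower_central_series G n" "g \<in> carrier G"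
  shows "x \<otimes>\<^bsub>G\<^esub> g \<otimes>\<^bsub>G\<^esub> inv\<^bsub>G\<^esub> x \<otimes>\<^bsub>G\<^esub> inv\<^bsub>G\<^esub> g \<in> lower_central_series G (Suc n)"
  using assms by (auto intro!: generate.incl)

lemma lower_central_series_SucI:
  assumes "group G" "subgroup K G"
    and "\<And>x g. \<lbrakk>x \<in> lower_central_series G n; g \<in> carrier G\<rbrakk>
      \<Longrightarrow> x \<otimes>\<^bsub>G\<^esub> g \<otimes>\<^bsub>G\<^esub> inv\<^bsub>G\<^esub> x \<otimes>\<^bsub>G\<^esub> inv\<^bsub>G\<^esub> g \<in> K"
  shows "lower_central_series G (Suc n) \<subseteq> K"
  unfolding lower_central_series.simps
  by (rule group.generate_subgroup_incl[OF assms(1) _ assms(2)]) (use assms(3) in auto)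

lemma lower_central_series_image:
  assumes "group_hom G H f"
  shows "f ` lower_central_series G n \<subseteq> lower_central_series H n"
proof (induction n)
  case 0
  interpret group_hom G H f by fact
  show ?case by auto
next
  case (Suc n)
  interpret group_hom G H f by fact
  have gens: "{x \<otimes>\<^bsub>G\<^esub> g \<otimes>\<^bsub>G\<^esub> inv\<^bsub>G\<^esub> x \<otimes>\<^bsub>G\<^esub> inv\<^bsub>G\<^esub> g | x g.
      x \<in> lower_central_series G n \<and> g \<in> carrier G} \<subseteq> carrier G"
    using subgroup.mem_carrier[OF lower_central_series_subgroup[OF G.is_group]] by auto
  have "f ` lower_central_series G (Suc n) = generate H (f ` {x \<otimes>\<^bsub>G\<^esub> g \<otimes>\<^bsub>G\<^esub> inv\<^bsub>G\<^esub> x \<otimes>\<^bsub>G\<^esub> inv\<^bsub>G\<^esub> g | x g.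
      x \<in> lower_central_series G n \<and> g \<in> carrier G})"
    using generate_img[OF gens] by simp
  also have "\<dots> \<subseteq> lower_central_series H (Suc n)"
    unfolding lower_central_series.simps(2)[of H]
  proof (rule H.mono_generate, safe)
    fix x g
    assume x: "x \<in> lower_central_series G n" and g: "g \<in> carrier G"
    then have "x \<in> carrier G"
      using subgroup.mem_carrier[OF lower_central_series_subgroup[OF G.is_group]] by blast
    with x g show "\<exists>x' g'. f (x \<otimes>\<^bsub>G\<^esub> g \<otimes>\<^bsub>G\<^esub> inv\<^bsub>G\<^esub> x \<otimes>\<^bsub>G\<^esub> inv\<^bsub>G\<^esub> g) =
        x' \<otimes>\<^bsub>H\<^esub> g' \<otimes>\<^bsub>H\<^esub> inv\<^bsub>H\<^esub> x' \<otimes>\<^bsub>H\<^esub> inv\<^bsub>H\<^esub> g' \<and> x' \<in> lower_central_series H n \<and> g' \<in> carrier H"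
      using Suc by (intro exI[of _ "f x"] exI[of _ "f g"]) auto
  qed
  finally show ?case .
qed

lemma lower_central_series_surj_image:
  assumes "group_hom G H f" and surj: "f ` carrier G = carrier H"
  shows "lower_central_series H n \<subseteq> f ` lower_central_series G n"
proof (induction n)
  case 0
  show ?case using surj by simp
next
  case (Suc n)
  interpret group_hom G H f by fact
  have sub: "subgroup (f ` lower_central_series G (Suc n)) H"
    by (rule subgroup_img_is_subgroup[OF lower_central_series_subgroup[OF G.is_group]])
  show ?case
  proof (rule lower_central_series_SucI[OF H.is_group sub])
    fix x' g' assume "x' \<in> lower_central_series H n" "g' \<in> carrier H"
    then obtain x g where x: "x \<in> lower_central_series G n" "x' = f x"
      and g: "g \<in> carrier G" "g' = f g"
      using Suc surj by blast
    have "x \<in> carrier G"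
      using subgroup.mem_carrier[OF lower_central_series_subgroup[OF G.is_group]] x by blast
    then have "x' \<otimes>\<^bsub>H\<^esub> g' \<otimes>\<^bsub>H\<^esub> inv\<^bsub>H\<^esub> x' \<otimes>\<^bsub>H\<^esub> inv\<^bsub>H\<^esub> g' =
        f (x \<otimes>\<^bsub>G\<^esub> g \<otimes>\<^bsub>G\<^esub> inv\<^bsub>G\<^esub> x \<otimes>\<^bsub>G\<^esub> inv\<^bsub>G\<^esub> g)"
      using x g by simp
    then show "x' \<otimes>\<^bsub>H\<^esub> g' \<otimes>\<^bsub>H\<^esub> inv\<^bsub>H\<^esub> x' \<otimes>\<^bsub>H\<^esub> inv\<^bsub>H\<^esub> g' \<in> f ` lower_central_series G (Suc n)"
      using lower_central_series_commutator[OF x(1) g(1)] by blast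
  qed
qed

lemma nilpotent_group_inj:
  assumes "group_hom G H f" "inj_on f (carrier G)" "nilpotent_group H"
  shows "nilpotent_group G"
proof -
  interpret group_hom G H f by fact
  obtain n where n: "lower_central_series H n = {\<one>\<^bsub>H\<^esub>}"
    using assms(3) unfolding nilpotent_group_def by blast
  interpret L: subgroup "lower_central_series G n" G
    by (rule lower_central_series_subgroup[OF G.is_group])
  have "x = \<one>\<^bsub>G\<^esub>" if "x \<in> lower_central_series G n" for x
  proof -
    have "f x = f \<one>\<^bsub>G\<^esub>"
      using lower_central_series_image[OF assms(1), of n] n that by auto
    then show ?thesis
      using assms(2) L.mem_carrier[OF that] inj_onD[of f "carrier G" x "\<one>\<^bsub>G\<^esub>"] by simp
  qed
  then have "lower_central_series G n = {\<one>\<^bsub>G\<^esub>}"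
    using L.one_closed by blast
  then show ?thesis
    unfolding nilpotent_group_def using G.is_group by blast
qed

lemma nilpotent_group_surj:
  assumes "group_hom G H f" "f ` carrier G = carrier H" "nilpotent_group G"
  shows "nilpotent_group H"
proof -
  interpret group_hom G H f by fact
  obtain n where n: "lower_central_series G n = {\<one>\<^bsub>G\<^esub>}"
    using assms(3) unfolding nilpotent_group_def by blast
  have "lower_central_series H n \<subseteq> {\<one>\<^bsub>H\<^esub>}"
    using lower_central_series_surj_image[OF assms(1,2), of n] n by auto
  then have "lower_central_series H n = {\<one>\<^bsub>H\<^esub>}"
    using subgroup.one_closed[OF lower_central_series_subgroup[OF H.is_group]] by blast
  then show ?thesis
    unfolding nilpotent_group_def using H.is_group by blast
qed

lemma lower_central_series_antimono:
  assumes "group G" "m \<le> n"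
  shows "lower_central_series G n \<subseteq> lower_central_series G m"
  using assms(2)
proof (induction n rule: dec_induct)
  case (step n)
  interpret group G by fact
  interpret N: normal "lower_central_series G n" G
    by (rule lower_central_series_normal[OF assms(1)])
  have "lower_central_series G (Suc n) \<subseteq> lower_central_series G n"
  proof (rule lower_central_series_SucI[OF assms(1) N.subgroup_axioms])
    fix x g assume x: "x \<in> lower_central_series G n" and g: "g \<in> carrier G"
    have "g \<otimes>\<^bsub>G\<^esub> inv\<^bsub>G\<^esub> x \<otimes>\<^bsub>G\<^esub> inv\<^bsub>G\<^esub> g \<in> lower_central_series G n"
      using N.inv_op_closed2 g x N.m_inv_closed by blast
    then show "x \<otimes>\<^bsub>G\<^esub> g \<otimes>\<^bsub>G\<^esub> inv\<^bsub>G\<^esub> x \<otimes>\<^bsub>G\<^esub> inv\<^bsub>G\<^esub> g \<in> lower_central_series G n"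
      using N.m_closed[OF x, of "g \<otimes>\<^bsub>G\<^esub> inv\<^bsub>G\<^esub> x \<otimes>\<^bsub>G\<^esub> inv\<^bsub>G\<^esub> g"] x g
      by (simp add: m_assoc)
  qed
  with step show ?case by blast
qed simp

lemma nilpotent_group_DirProd:
  assumes "nilpotent_group G" "nilpotent_group H"
  shows "nilpotent_group (G \<times>\<times> H)"
proof -
  interpret G: group G using assms(1) by (simp add: nilpotent_group_def)
  interpret H: group H using assms(2) by (simp add: nilpotent_group_def)
  interpret GH: group "G \<times>\<times> H" by (rule DirProd_group[OF G.is_group H.is_group])
  have fst: "group_hom (G \<times>\<times> H) G fst" and snd: "group_hom (G \<times>\<times> H) H snd"
    by unfold_locales (auto simp: hom_def)
  obtain m n where m: "lower_central_series G m = {\<one>\<^bsub>G\<^esub>}"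
    and n: "lower_central_series H n = {\<one>\<^bsub>H\<^esub>}"
    using assms unfolding nilpotent_group_def by blast
  have "lower_central_series (G \<times>\<times> H) (max m n) \<subseteq> {\<one>\<^bsub>G \<times>\<times> H\<^esub>}"
  proof
    fix x assume x: "x \<in> lower_central_series (G \<times>\<times> H) (max m n)"
    have "fst x \<in> lower_central_series G m"
      using x lower_central_series_image[OF fst, of "max m n"]
        lower_central_series_antimono[OF G.is_group, of m "max m n"] by auto
    moreover have "snd x \<in> lower_central_series H n"
      using x lower_central_series_image[OF snd, of "max m n"]
        lower_central_series_antimono[OF H.is_group, of n "max m n"] by auto
    ultimately show "x \<in> {\<one>\<^bsub>G \<times>\<times> H\<^esub>}"
      using m n by (cases x) simp
  qed
  then have "lower_central_series (G \<times>\<times> H) (max m n) = {\<one>\<^bsub>G \<times>\<times> H\<^esub>}"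
    using subgroup.one_closed[OF lower_central_series_subgroup[OF GH.is_group]] by blast
  then show ?thesis
    unfolding nilpotent_group_def using GH.is_group by blast
qed

section \<open>Finite nilpotent groups\<close>

text \<open>
  If the commutator \<open>c\<close> of \<open>x\<close> and \<open>y\<close> commutes with \<open>x\<close>, then the commutator of \<open>x [^] k\<close> and \<open>y\<close> is
  \<open>c [^] k\<close>.
\<close>

lemma (in group) pow_swap_up_to_commuting_factor:
  fixes k :: nat
  assumes "x \<in> carrier G" "y \<in> carrier G" "c \<in> carrier G"
    and comm: "x \<otimes> c = c \<otimes> x" and xy: "x \<otimes> y = c \<otimes> (y \<otimes> x)"
  shows "x [^] k \<otimes> y = c [^] k \<otimes> (y \<otimes> x [^] k)"
proof (induction k)
  case 0
  show ?case using assms by simp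
next
  case (Suc k)
  have ck: "x [^] k \<otimes> c = c \<otimes> x [^] k"
    using assms comm by (simp add: group_commutes_pow)
  have "x [^] Suc k \<otimes> y = x [^] k \<otimes> (c \<otimes> (y \<otimes> x))"
    using assms by (simp add: m_assoc)
  also have "\<dots> = c \<otimes> (x [^] k \<otimes> y) \<otimes> x"
    using assms ck by (simp flip: m_assoc)
  also have "\<dots> = (c \<otimes> c [^] k) \<otimes> (y \<otimes> (x [^] k \<otimes> x))"
    unfolding Suc using assms by (simp add: m_assoc)
  also have "c \<otimes> c [^] k = c [^] Suc k"
    using assms(3) by (metis nat_pow_Suc nat_pow_Suc2)
  finally show ?case by simp
qed

lemma (in group) commutator_eq_one_if_coprime_pow_eq_one:
  fixes m n :: nat
  assumes x: "x \<in> carrier G" and y: "y \<in> carrier G" and c: "c \<in> carrier G"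
    and cx: "x \<otimes> c = c \<otimes> x" and cy: "y \<otimes> c = c \<otimes> y" and xy: "x \<otimes> y = c \<otimes> (y \<otimes> x)"
    and n: "x [^] n = \<one>" and m: "y [^] m = \<one>" and co: "coprime n m"
  shows "c = \<one>"
proof -
  have "c [^] n = \<one>"
  proof -
    have "c [^] n \<otimes> y = \<one> \<otimes> y"
      using pow_swap_up_to_commuting_factor[OF x y c cx xy, of n] x y c n by simp
    then show ?thesis using right_cancel[of y "c [^] n" \<one>] y c by simp
  qed
  moreover have "c [^] m = \<one>"
  proof -
    have yx: "y \<otimes> x = inv c \<otimes> (x \<otimes> y)"
      unfolding xy using x y c by (simp add: inv_mult_cancel)
    have cy': "y \<otimes> inv c = inv c \<otimes> y"
      using cy y c by (metis inv_closed inv_solve_left inv_solve_right m_assoc m_closed)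
    have "inv c [^] m \<otimes> x = \<one> \<otimes> x"
      using pow_swap_up_to_commuting_factor[OF y x inv_closed[OF c] cy' yx, of m] x y c m by simp
    then have "inv c [^] m = \<one>" using right_cancel[of x "inv c [^] m" \<one>] x c by simp
    then show ?thesis using c by (metis inv_inv inv_one nat_pow_inv nat_pow_closed inv_closed)
  qed
  ultimately have "ord c dvd n" "ord c dvd m"
    using pow_eq_id[OF c] by blast+
  then have "ord c = 1" using co by (meson coprime_common_divisor_nat)
  then show ?thesis using ord_eq_1[OF c] by simp
qed

text \<open>
  By induction the commutator of \<open>x\<close> and \<open>y\<close> lies in every term of the lower central series: if it lies
  in one term, it is central modulo the next, and the preceding lemma applies in the quotient.
\<close>

lemma nilpotent_group_commute_if_coprime_pow_eq_one:
  fixes m n :: nat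
  assumes nil: "nilpotent_group G" and x: "x \<in> carrier G" and y: "y \<in> carrier G"
    and n: "x [^]\<^bsub>G\<^esub> n = \<one>\<^bsub>G\<^esub>" and m: "y [^]\<^bsub>G\<^esub> m = \<one>\<^bsub>G\<^esub>" and co: "coprime n m"
  shows "x \<otimes>\<^bsub>G\<^esub> y = y \<otimes>\<^bsub>G\<^esub> x"
proof -
  interpret group G using nil by (simp add: nilpotent_group_def)
  define c where "c = x \<otimes>\<^bsub>G\<^esub> y \<otimes>\<^bsub>G\<^esub> inv\<^bsub>G\<^esub> x \<otimes>\<^bsub>G\<^esub> inv\<^bsub>G\<^esub> y"
  have c: "c \<in> carrier G" unfolding c_def using x y by simp
  have xy: "x \<otimes>\<^bsub>G\<^esub> y = c \<otimes>\<^bsub>G\<^esub> (y \<otimes>\<^bsub>G\<^esub> x)"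
    unfolding c_def using x y by (simp add: m_assoc inv_mult_cancel)
  have "c \<in> lower_central_series G i" for i
  proof (induction i)
    case 0
    show ?case using c by simp
  next
    case (Suc i)
    define N where "N = lower_central_series G (Suc i)"
    interpret N: normal N G
      unfolding N_def by (rule lower_central_series_normal[OF is_group])
    interpret Q: group "G Mod N" by (rule N.factorgroup_is_group)
    interpret pr: group_hom G "G Mod N" "\<lambda>a. N #>\<^bsub>G\<^esub> a"
      by unfold_locales (rule N.r_coset_hom_Mod)
    have central: "(N #>\<^bsub>G\<^esub> a) \<otimes>\<^bsub>G Mod N\<^esub> (N #>\<^bsub>G\<^esub> c) = (N #>\<^bsub>G\<^esub> c) \<otimes>\<^bsub>G Mod N\<^esub> (N #>\<^bsub>G\<^esub> a)"
      if a: "a \<in> carrier G" for a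
    proof -
      have "c \<otimes>\<^bsub>G\<^esub> a \<otimes>\<^bsub>G\<^esub> inv\<^bsub>G\<^esub> c \<otimes>\<^bsub>G\<^esub> inv\<^bsub>G\<^esub> a \<in> N"
        unfolding N_def using lower_central_series_commutator[OF Suc a] .
      moreover have "c \<otimes>\<^bsub>G\<^esub> a = (c \<otimes>\<^bsub>G\<^esub> a \<otimes>\<^bsub>G\<^esub> inv\<^bsub>G\<^esub> c \<otimes>\<^bsub>G\<^esub> inv\<^bsub>G\<^esub> a) \<otimes>\<^bsub>G\<^esub> (a \<otimes>\<^bsub>G\<^esub> c)"
        using a c by (simp add: m_assoc inv_mult_cancel)
      ultimately have "c \<otimes>\<^bsub>G\<^esub> a \<in> N #>\<^bsub>G\<^esub> (a \<otimes>\<^bsub>G\<^esub> c)"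
        unfolding r_coset_def by blast
      then have "N #>\<^bsub>G\<^esub> (a \<otimes>\<^bsub>G\<^esub> c) = N #>\<^bsub>G\<^esub> (c \<otimes>\<^bsub>G\<^esub> a)"
        by (rule repr_independence[OF _ m_closed[OF a c] N.subgroup_axioms])
      then show ?thesis using a c pr.hom_mult by metis
    qed
    have "N #>\<^bsub>G\<^esub> c = \<one>\<^bsub>G Mod N\<^esub>"
    proof (rule Q.commutator_eq_one_if_coprime_pow_eq_one[OF _ _ _ central central _ _ _ co])
      show "(N #>\<^bsub>G\<^esub> x) \<otimes>\<^bsub>G Mod N\<^esub> (N #>\<^bsub>G\<^esub> y) =
          (N #>\<^bsub>G\<^esub> c) \<otimes>\<^bsub>G Mod N\<^esub> ((N #>\<^bsub>G\<^esub> y) \<otimes>\<^bsub>G Mod N\<^esub> (N #>\<^bsub>G\<^esub> x))"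
        using xy x y c pr.hom_mult m_closed by metis
      show "(N #>\<^bsub>G\<^esub> x) [^]\<^bsub>G Mod N\<^esub> n = \<one>\<^bsub>G Mod N\<^esub>"
        using pr.hom_nat_pow[OF x, of n] n pr.hom_one by simp
      show "(N #>\<^bsub>G\<^esub> y) [^]\<^bsub>G Mod N\<^esub> m = \<one>\<^bsub>G Mod N\<^esub>"
        using pr.hom_nat_pow[OF y, of m] m pr.hom_one by simp
    qed (use x y c pr.hom_closed in auto)
    then have "N #>\<^bsub>G\<^esub> c = N" by simp
    then have "c \<in> N" using c by (metis rcos_self N.subgroup_axioms)
    then show ?case unfolding N_def .
  qed
  then have "c = \<one>\<^bsub>G\<^esub>"
    using nil unfolding nilpotent_group_def by blast
  then show ?thesis using xy x y by simp
qed

lemma (in group) pow_card_subgroup_eq_one: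
  assumes "subgroup S G" "x \<in> S"
  shows "x [^] card S = \<one>"
proof -
  interpret S: group "G\<lparr>carrier := S\<rparr>" by (rule subgroup_imp_group[OF assms(1)])
  have "x [^]\<^bsub>G\<lparr>carrier := S\<rparr>\<^esub> order (G\<lparr>carrier := S\<rparr>) = \<one>\<^bsub>G\<lparr>carrier := S\<rparr>\<^esub>"
    by (rule S.pow_order_eq_1) (use assms in simp)
  then show ?thesis by (simp add: order_def flip: nat_pow_consistent)
qed

lemma (in group) card_subgroup_dvd:
  assumes "subgroup S G" "subgroup K G" "S \<subseteq> K"
  shows "card S dvd card K"
proof -
  interpret K: group "G\<lparr>carrier := K\<rparr>" by (rule subgroup_imp_group[OF assms(2)])
  have "subgroup S (G\<lparr>carrier := K\<rparr>)"
    by (rule subgroup_incl[OF assms])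
  then have "card S dvd order (G\<lparr>carrier := K\<rparr>)"
    using K.lagrange by (metis dvd_triv_right)
  then show ?thesis by (simp add: order_def)
qed

text \<open>
  The order of \<open>K\<close> is divisible by the full power of every prime that divides the order of the group.
\<close>

lemma (in group) subgroup_eq_carrier_if_contains_Sylow:
  assumes fin: "finite (carrier G)" and K: "subgroup K G"
    and "\<And>p. prime p \<Longrightarrow> \<exists>S. subgroup S G \<and> S \<subseteq> K \<and> card S = p ^ multiplicity p (order G)"
  shows "K = carrier G"
proof -
  have ord0: "order G \<noteq> 0" using fin by (simp add: order_gt_0_iff_finite)
  have K0: "card K \<noteq> 0"
    using subgroup.finite_imp_card_positive[OF K fin] by simp
  have "order G dvd card K"
  proof (rule multiplicity_le_imp_dvd[OF ord0])
    fix p :: nat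
    assume p: "prime p"
    with assms(3) obtain S where "subgroup S G" "S \<subseteq> K" "card S = p ^ multiplicity p (order G)"
      by blast
    then have "p ^ multiplicity p (order G) dvd card K"
      using card_subgroup_dvd[OF _ K] by metis
    then show "multiplicity p (order G) \<le> multiplicity p (card K)"
      using p K0 by (intro multiplicity_geI) auto
  qed
  then have "card (carrier G) \<le> card K"
    using K0 by (auto simp: order_def dest: dvd_imp_le)
  then show ?thesis
    using card_seteq[OF fin subgroup.subset[OF K]] by blast
qed

text \<open>
  The elements of \<open>p\<close>-power order in a finite group, for a prime \<open>p\<close>; the exponent is the largest power of \<open>p\<close>
  dividing the order of the group.
\<close>

definition p_torsion :: "('a, 'b) monoid_scheme \<Rightarrow> nat \<Rightarrow> 'a set" where
  "p_torsion G p = {x \<in> carrier G. x [^]\<^bsub>G\<^esub> (p ^ multiplicity p (order G)) = \<one>\<^bsub>G\<^esub>}"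

lemma (in group) Sylow_subgroup_exists:
  assumes "finite (carrier G)" "prime p"
  shows "\<exists>S. subgroup S G \<and> card S = p ^ multiplicity p (order G)"
proof -
  obtain m where "order G = p ^ multiplicity p (order G) * m"
    using multiplicity_dvd by (metis dvdE)
  then show ?thesis
    by (rule sylow_thm[OF assms(2) is_group _ assms(1)])
qed

lemma (in group) normal_eq_p_torsion:
  assumes fin: "finite (carrier G)" and p: "prime p" and S: "S \<lhd> G"
    and card: "card S = p ^ multiplicity p (order G)"
  shows "p_torsion G p = S"
proof
  interpret S: normal S G by (rule S)
  interpret Q: group "G Mod S" by (rule S.factorgroup_is_group)
  have ord0: "order G \<noteq> 0" using fin by (simp add: order_gt_0_iff_finite)
  show "S \<subseteq> p_torsion G p"
    using pow_card_subgroup_eq_one[OF S.subgroup_axioms] S.subset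
    unfolding p_torsion_def card by auto
  show "p_torsion G p \<subseteq> S"
  proof
    fix x assume "x \<in> p_torsion G p"
    then have x: "x \<in> carrier G" and xp: "x [^] (p ^ multiplicity p (order G)) = \<one>"
      unfolding p_torsion_def by auto
    define X where "X = S #> x"
    have X: "X \<in> carrier (G Mod S)"
      unfolding X_def carrier_FactGroup using x by simp
    have ordQ: "order (G Mod S) * p ^ multiplicity p (order G) = order G"
      using lagrange[OF S.subgroup_axioms] card by (simp add: order_def FactGroup_def)
    have "\<not> p dvd order (G Mod S)"
    proof
      assume "p dvd order (G Mod S)"
      then have "p ^ Suc (multiplicity p (order G)) dvd order G"
        using mult_dvd_mono[of p "order (G Mod S)" "p ^ multiplicity p (order G)" "p ^ multiplicity p (order G)"] ordQ
        by simp
      then show False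
        using multiplicity_geI[OF ord0, of p "Suc (multiplicity p (order G))"] p
        by (metis not_prime_unit not_less_eq_eq order_refl)
    qed
    then have co: "coprime (p ^ multiplicity p (order G)) (order (G Mod S))"
      using p by (simp add: prime_imp_coprime)
    have "X [^]\<^bsub>G Mod S\<^esub> (p ^ multiplicity p (order G)) = \<one>\<^bsub>G Mod S\<^esub>"
      unfolding X_def S.FactGroup_pow[OF x] xp by (simp add: S.subset)
    moreover have "X [^]\<^bsub>G Mod S\<^esub> order (G Mod S) = \<one>\<^bsub>G Mod S\<^esub>"
      by (rule Q.pow_order_eq_1[OF X])
    ultimately have "Q.ord X = 1"
      using co by (meson Q.pow_eq_id X coprime_common_divisor_nat)
    then have "S #> x = S" using Q.ord_eq_1[OF X] unfolding X_def by simp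
    then show "x \<in> S" using x by (metis rcos_self S.subgroup_axioms)
  qed
qed

text \<open>
  A subgroup is generated by its Sylow subgroups, which consist of elements of prime power order.
\<close>

lemma (in group) subgroup_subset_if_p_torsion_subset:
  assumes fin: "finite (carrier G)" and Z: "subgroup Z G" and F: "subgroup F G"
    and sub: "\<And>p. prime p \<Longrightarrow> Z \<inter> p_torsion G p \<subseteq> F"
  shows "Z \<subseteq> F"
proof -
  interpret Z: group "G\<lparr>carrier := Z\<rparr>" by (rule subgroup_imp_group[OF Z])
  have finZ: "finite Z" using fin subgroup.subset[OF Z] finite_subset by blast
  have ord0: "order G \<noteq> 0" using fin by (simp add: order_gt_0_iff_finite)
  have "subgroup (Z \<inter> F) (G\<lparr>carrier := Z\<rparr>)"
    by (rule subgroup_incl[OF subgroups_Inter_pair[OF Z F] Z]) simp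
  then have "Z \<inter> F = carrier (G\<lparr>carrier := Z\<rparr>)"
  proof (rule Z.subgroup_eq_carrier_if_contains_Sylow[rotated])
    fix p :: nat assume p: "prime p"
    obtain S where S: "subgroup S (G\<lparr>carrier := Z\<rparr>)"
      and card: "card S = p ^ multiplicity p (order (G\<lparr>carrier := Z\<rparr>))"
      using Z.Sylow_subgroup_exists[OF _ p] finZ by auto
    have SZ: "S \<subseteq> Z" using subgroup.subset[OF S] by simp
    have SA: "subgroup S G" using incl_subgroup[OF Z S] .
    have "order (G\<lparr>carrier := Z\<rparr>) dvd order G"
      using card_subgroup_dvd[OF Z subgroup_self subgroup.subset[OF Z]] by (simp add: order_def)
    then have "card S dvd p ^ multiplicity p (order G)"
      unfolding card using ord0 by (simp add: dvd_imp_multiplicity_le le_imp_power_dvd)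
    then have "x [^] (p ^ multiplicity p (order G)) = \<one>" if "x \<in> S" for x
      using pow_card_subgroup_eq_one[OF SA that] subgroup.mem_carrier[OF SA that]
      by (meson dvd_trans pow_eq_id)
    then have "S \<subseteq> p_torsion G p"
      unfolding p_torsion_def using subgroup.mem_carrier[OF SA] by blast
    then have "S \<subseteq> Z \<inter> F" using sub[OF p] SZ by blast
    then show "\<exists>S. subgroup S (G\<lparr>carrier := Z\<rparr>) \<and> S \<subseteq> Z \<inter> F \<and>
        card S = p ^ multiplicity p (order (G\<lparr>carrier := Z\<rparr>))"
      using S card by blast
  qed (use finZ in simp)
  then show ?thesis by auto
qed

text \<open>
  A Sylow \<open>p\<close>-subgroup of a finite nilpotent group is normalised by itself and centralised by the Sylow
  subgroups for the other primes, so its normaliser is the whole group.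
\<close>

theorem nilpotent_group_p_torsion:
  assumes nil: "nilpotent_group G" and fin: "finite (carrier G)" and p: "prime p"
  shows "p_torsion G p \<lhd> G" and "card (p_torsion G p) = p ^ multiplicity p (order G)"
proof -
  interpret group G using nil by (simp add: nilpotent_group_def)
  obtain S where S: "subgroup S G" and card: "card S = p ^ multiplicity p (order G)"
    using Sylow_subgroup_exists[OF fin p] by blast
  interpret S: subgroup S G by (rule S)
  \<comment> \<open>The normaliser of \<open>S\<close>; conditions for both \<open>g\<close> and its inverse make closure under inverses
    immediate.\<close>
  define N where "N = {g \<in> carrier G. \<forall>s\<in>S. g \<otimes>\<^bsub>G\<^esub> s \<otimes>\<^bsub>G\<^esub> inv\<^bsub>G\<^esub> g \<in> S \<and> inv\<^bsub>G\<^esub> g \<otimes>\<^bsub>G\<^esub> s \<otimes>\<^bsub>G\<^esub> g \<in> S}"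
  have N: "subgroup N G"
  proof (rule subgroupI)
    show "N \<subseteq> carrier G" "N \<noteq> {}" unfolding N_def by (auto intro!: exI[of _ "\<one>\<^bsub>G\<^esub>"])
    show "inv\<^bsub>G\<^esub> g \<in> N" if "g \<in> N" for g using that unfolding N_def by auto
    show "g \<otimes>\<^bsub>G\<^esub> h \<in> N" if g: "g \<in> N" and h: "h \<in> N" for g h
    proof -
      have gc: "g \<in> carrier G" and hc: "h \<in> carrier G" using g h unfolding N_def by auto
      have "(g \<otimes>\<^bsub>G\<^esub> h) \<otimes>\<^bsub>G\<^esub> s \<otimes>\<^bsub>G\<^esub> inv\<^bsub>G\<^esub> (g \<otimes>\<^bsub>G\<^esub> h) = g \<otimes>\<^bsub>G\<^esub> (h \<otimes>\<^bsub>G\<^esub> s \<otimes>\<^bsub>G\<^esub> inv\<^bsub>G\<^esub> h) \<otimes>\<^bsub>G\<^esub> inv\<^bsub>G\<^esub> g"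
        "inv\<^bsub>G\<^esub> (g \<otimes>\<^bsub>G\<^esub> h) \<otimes>\<^bsub>G\<^esub> s \<otimes>\<^bsub>G\<^esub> (g \<otimes>\<^bsub>G\<^esub> h) = inv\<^bsub>G\<^esub> h \<otimes>\<^bsub>G\<^esub> (inv\<^bsub>G\<^esub> g \<otimes>\<^bsub>G\<^esub> s \<otimes>\<^bsub>G\<^esub> g) \<otimes>\<^bsub>G\<^esub> h"
        if "s \<in> S" for s using gc hc S.mem_carrier[OF that] by (simp_all add: m_assoc inv_mult_group)
      then show ?thesis using g h unfolding N_def by auto
    qed
  qed
  have "N = carrier G"
  proof (rule subgroup_eq_carrier_if_contains_Sylow[OF fin N])
    fix q :: nat assume q: "prime q"
    show "\<exists>T. subgroup T G \<and> T \<subseteq> N \<and> card T = q ^ multiplicity q (order G)"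
    proof (cases "q = p")
      case True
      have "S \<subseteq> N"
        unfolding N_def using S.mem_carrier by auto
      then show ?thesis using S card True by blast
    next
      case False
      obtain T where T: "subgroup T G" and cardT: "card T = q ^ multiplicity q (order G)"
        using Sylow_subgroup_exists[OF fin q] by blast
      interpret T: subgroup T G by (rule T)
      have co: "coprime (card T) (card S)"
        unfolding card cardT using primes_coprime[OF q p False] by simp
      have comm: "t \<otimes>\<^bsub>G\<^esub> s = s \<otimes>\<^bsub>G\<^esub> t" if t: "t \<in> T" and s: "s \<in> S" for t s
        by (rule nilpotent_group_commute_if_coprime_pow_eq_one[OF nil
              T.mem_carrier[OF t] S.mem_carrier[OF s] pow_card_subgroup_eq_one[OF T t]
              pow_card_subgroup_eq_one[OF S s] co])
      have "T \<subseteq> N"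
      proof
        fix t assume t: "t \<in> T"
        have "t \<otimes>\<^bsub>G\<^esub> s \<otimes>\<^bsub>G\<^esub> inv\<^bsub>G\<^esub> t = s" "inv\<^bsub>G\<^esub> t \<otimes>\<^bsub>G\<^esub> s \<otimes>\<^bsub>G\<^esub> t = s" if s: "s \<in> S" for s
        proof -
          show "t \<otimes>\<^bsub>G\<^esub> s \<otimes>\<^bsub>G\<^esub> inv\<^bsub>G\<^esub> t = s"
            using comm[OF t s] T.mem_carrier[OF t] S.mem_carrier[OF s] by (simp add: m_assoc)
          show "inv\<^bsub>G\<^esub> t \<otimes>\<^bsub>G\<^esub> s \<otimes>\<^bsub>G\<^esub> t = s"
            using comm[OF t s] T.mem_carrier[OF t] S.mem_carrier[OF s]
            by (simp add: m_assoc inv_mult_cancel flip: comm[OF t s])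
        qed
        then show "t \<in> N" unfolding N_def using T.mem_carrier[OF t] by auto
      qed
      then show ?thesis using T cardT by blast
    qed
  qed
  then have "S \<lhd> G"
    using S unfolding normal_inv_iff N_def by blast
  then show "p_torsion G p \<lhd> G" "card (p_torsion G p) = p ^ multiplicity p (order G)"
    using normal_eq_p_torsion[OF fin p _ card] card by auto
qed

section \<open>Fixed points of \<open>p\<close>-groups\<close>

text \<open>
  A \<open>p\<close>-group \<open>P\<close> that acts by automorphisms on a \<open>p\<close>-group \<open>Y\<close> and preserves a proper subgroup \<open>W\<close>
  acts on the right cosets of \<open>W\<close>. Their number is divisible by \<open>p\<close>, so besides \<open>W\<close> itself another coset
  is fixed. Normality of \<open>W\<close> plays no role.
\<close>

lemma p_group_fixed_coset:
  fixes P :: "('a, 'b) monoid_scheme" and Y :: "('c, 'd) monoid_scheme" and \<theta> :: "'a \<Rightarrow> 'c \<Rightarrow> 'c"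
  assumes P: "group P" and Y: "group Y" and p: "prime p"
    and ordP: "order P = p ^ a" and ordY: "order Y = p ^ b"
    and W: "subgroup W Y" and W_ne: "W \<noteq> carrier Y"
    and hom: "\<And>g. g \<in> carrier P \<Longrightarrow> \<theta> g \<in> hom Y Y"
    and mult: "\<And>g h y. \<lbrakk>g \<in> carrier P; h \<in> carrier P; y \<in> carrier Y\<rbrakk> \<Longrightarrow> \<theta> (g \<otimes>\<^bsub>P\<^esub> h) y = \<theta> g (\<theta> h y)"
    and one: "\<And>y. y \<in> carrier Y \<Longrightarrow> \<theta> \<one>\<^bsub>P\<^esub> y = y"
    and inv: "\<And>g w. \<lbrakk>g \<in> carrier P; w \<in> W\<rbrakk> \<Longrightarrow> \<theta> g w \<in> W"
  shows "\<exists>y \<in> carrier Y - W. \<forall>g \<in> carrier P. \<theta> g y \<otimes>\<^bsub>Y\<^esub> inv\<^bsub>Y\<^esub> y \<in> W"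
proof -
  interpret P: group P by (rule P)
  interpret Y: group Y by (rule Y)
  interpret W: subgroup W Y by (rule W)
  have \<theta>Y [simp]: "\<theta> g y \<in> carrier Y" if "g \<in> carrier P" "y \<in> carrier Y" for g y
    using hom[OF that(1)] that(2) by (auto simp: hom_def)
  have \<theta>m: "\<theta> g (y \<otimes>\<^bsub>Y\<^esub> z) = \<theta> g y \<otimes>\<^bsub>Y\<^esub> \<theta> g z" if "g \<in> carrier P" "y \<in> carrier Y" "z \<in> carrier Y" for g y z
    using hom[OF that(1)] that(2,3) by (auto simp: hom_def)
  have \<theta>inv: "\<theta> g (\<theta> (inv\<^bsub>P\<^esub> g) y) = y" if "g \<in> carrier P" "y \<in> carrier Y" for g y
    using mult[of g "inv\<^bsub>P\<^esub> g" y] one that by simp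
  define \<Omega> where "\<Omega> = rcosets\<^bsub>Y\<^esub> W"
  define \<phi> where "\<phi> g = restrict (\<lambda>X. \<theta> g ` X) \<Omega>" for g
  have \<Omega>E: "\<exists>y \<in> carrier Y. X = W #>\<^bsub>Y\<^esub> y" if "X \<in> \<Omega>" for X
    using that unfolding \<Omega>_def RCOSETS_def by blast
  have \<Omega>I: "W #>\<^bsub>Y\<^esub> y \<in> \<Omega>" if "y \<in> carrier Y" for y
    using that unfolding \<Omega>_def RCOSETS_def by blast
  have W\<Omega>: "W \<in> \<Omega>"
    using \<Omega>I[of "\<one>\<^bsub>Y\<^esub>"] by (simp add: Y.coset_mult_one W.subset)
  have \<theta>coset: "\<theta> g ` (W #>\<^bsub>Y\<^esub> y) = W #>\<^bsub>Y\<^esub> \<theta> g y" if g: "g \<in> carrier P" and y: "y \<in> carrier Y" for g y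
  proof
    show "\<theta> g ` (W #>\<^bsub>Y\<^esub> y) \<subseteq> W #>\<^bsub>Y\<^esub> \<theta> g y"
      unfolding r_coset_def using \<theta>m[OF g W.mem_carrier y] inv[OF g] by auto
    show "W #>\<^bsub>Y\<^esub> \<theta> g y \<subseteq> \<theta> g ` (W #>\<^bsub>Y\<^esub> y)"
    proof
      fix x assume "x \<in> W #>\<^bsub>Y\<^esub> \<theta> g y"
      then obtain w where w: "w \<in> W" "x = w \<otimes>\<^bsub>Y\<^esub> \<theta> g y" unfolding r_coset_def by blast
      have w': "\<theta> (inv\<^bsub>P\<^esub> g) w \<in> W" using inv[of "inv\<^bsub>P\<^esub> g" w] g w by simp
      have "x = \<theta> g (\<theta> (inv\<^bsub>P\<^esub> g) w \<otimes>\<^bsub>Y\<^esub> y)"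
        using \<theta>m[OF g W.mem_carrier[OF w'] y] \<theta>inv[OF g W.mem_carrier[OF w(1)]] w by simp
      then show "x \<in> \<theta> g ` (W #>\<^bsub>Y\<^esub> y)" unfolding r_coset_def using w' by blast
    qed
  qed
  have \<phi>coset: "\<phi> g (W #>\<^bsub>Y\<^esub> y) = W #>\<^bsub>Y\<^esub> \<theta> g y" if "g \<in> carrier P" "y \<in> carrier Y" for g y
    unfolding \<phi>_def using \<theta>coset[OF that] \<Omega>I[OF that(2)] by simp
  have \<phi>\<Omega>: "\<phi> g X \<in> \<Omega>" if "g \<in> carrier P" "X \<in> \<Omega>" for g X
    using \<Omega>E[OF that(2)] \<phi>coset[OF that(1)] \<Omega>I \<theta>Y[OF that(1)] by metis
  have \<phi>mult: "\<phi> (g \<otimes>\<^bsub>P\<^esub> h) X = \<phi> g (\<phi> h X)" if gh: "g \<in> carrier P" "h \<in> carrier P" and X: "X \<in> \<Omega>" for g h X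
    using \<Omega>E[OF X] gh \<phi>coset mult by (metis P.m_closed \<theta>Y)
  have \<phi>one: "\<phi> \<one>\<^bsub>P\<^esub> X = X" if "X \<in> \<Omega>" for X
    using \<Omega>E[OF that] \<phi>coset[OF P.one_closed] one by metis
  have \<phi>Bij: "\<phi> g \<in> Bij \<Omega>" if g: "g \<in> carrier P" for g
  proof -
    have "bij_betw (\<phi> g) \<Omega> \<Omega>"
    proof (rule bij_betwI[of _ _ _ "\<phi> (inv\<^bsub>P\<^esub> g)"])
      show "\<phi> (inv\<^bsub>P\<^esub> g) (\<phi> g X) = X" if "X \<in> \<Omega>" for X
        using \<phi>mult[of "inv\<^bsub>P\<^esub> g" g X] \<phi>one g that by simp
      show "\<phi> g (\<phi> (inv\<^bsub>P\<^esub> g) X) = X" if "X \<in> \<Omega>" for X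
        using \<phi>mult[of g "inv\<^bsub>P\<^esub> g" X] \<phi>one g that by simp
    qed (use \<phi>\<Omega> g in auto)
    then show ?thesis unfolding Bij_def by (simp add: \<phi>_def)
  qed
  interpret act: group_action P \<Omega> \<phi>
  proof (intro group_action.intro group_hom.intro group_hom_axioms.intro P group_BijGroup homI)
    show "\<phi> g \<in> carrier (BijGroup \<Omega>)" if "g \<in> carrier P" for g
      using \<phi>Bij[OF that] by (simp add: BijGroup_def)
    show "\<phi> (g \<otimes>\<^bsub>P\<^esub> h) = \<phi> g \<otimes>\<^bsub>BijGroup \<Omega>\<^esub> \<phi> h" if gh: "g \<in> carrier P" "h \<in> carrier P" for g h
    proof -
      have "\<phi> (g \<otimes>\<^bsub>P\<^esub> h) = compose \<Omega> (\<phi> g) (\<phi> h)"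
        by (rule extensionalityI[of _ \<Omega>]) (use \<phi>mult gh in \<open>auto simp: compose_def \<phi>_def\<close>)
      then show ?thesis using \<phi>Bij gh by (simp add: BijGroup_def)
    qed
  qed
  have finY: "finite (carrier Y)"
    using ordY p by (metis Y.order_gt_0_iff_finite prime_gt_0_nat zero_less_power)
  have fin\<Omega>: "finite \<Omega>"
    unfolding \<Omega>_def RCOSETS_def using finY by simp
  have card\<Omega>: "p dvd card \<Omega>"
  proof -
    have lag: "card \<Omega> * card W = p ^ b"
      using Y.lagrange[OF W] ordY unfolding \<Omega>_def by simp
    then obtain k where k: "card \<Omega> = p ^ k"
      using divides_primepow_nat[OF p] by (metis dvd_triv_left)
    have "k \<noteq> 0"
    proof
      assume "k = 0"
      then have "card W = order Y" using k lag ordY by simp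
      then have "W = carrier Y"
        using card_subset_eq[OF finY W.subset] by (simp add: order_def)
      with W_ne show False by simp
    qed
    then show ?thesis unfolding k by simp
  qed
  have orbW: "orbit P \<phi> W = {W}"
  proof -
    have "\<phi> g W = W" if "g \<in> carrier P" for g
      using \<phi>coset[OF that Y.one_closed] inv[OF that W.one_closed] W.subset
      by (metis Y.coset_mult_one Y.coset_join2 \<theta>Y[OF that Y.one_closed] W)
    then show ?thesis unfolding orbit_def using P.one_closed by blast
  qed
  obtain X where X: "X \<in> \<Omega>" "X \<noteq> W" and orbX: "card (orbit P \<phi> X) = 1"
  proof (rule ccontr)
    assume "\<not> thesis"
    then have ne: "card (orbit P \<phi> X) \<noteq> 1" if "X \<in> \<Omega>" "X \<noteq> W" for X
      using that \<open>\<And>X. \<lbrakk>X \<in> \<Omega>; X \<noteq> W; card (orbit P \<phi> X) = 1\<rbrakk> \<Longrightarrow> thesis\<close> by blast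
    let ?O = "orbits P \<Omega> \<phi>"
    have finO: "finite ?O" unfolding orbits_def using fin\<Omega> by simp
    have WO: "{W} \<in> ?O" unfolding orbits_def using orbW W\<Omega> by blast
    have "p dvd card Z" if Z: "Z \<in> ?O - {{W}}" for Z
    proof -
      obtain X where X: "X \<in> \<Omega>" "Z = orbit P \<phi> X" using Z unfolding orbits_def by blast
      then have "X \<noteq> W" using Z orbW by auto
      have "card Z dvd p ^ a"
        using act.orbit_stabilizer_theorem[OF X(1)] ordP X(2) by (metis dvd_triv_left)
      then obtain k where k: "card Z = p ^ k"
        using divides_primepow_nat[OF p] by blast
      then have "k \<noteq> 0" using ne[OF X(1) \<open>X \<noteq> W\<close>] X(2) by (metis power_0)
      then show ?thesis unfolding k by simp
    qed
    then have "p dvd (\<Sum>Z \<in> ?O - {{W}}. card Z)" by (rule dvd_sum)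
    moreover have "card \<Omega> = card {W} + (\<Sum>Z \<in> ?O - {{W}}. card Z)"
      using act.disjoint_sum[OF fin\<Omega>, of "\<lambda>_. 1::nat"] sum.remove[OF finO WO, of card] by simp
    ultimately have "p dvd 1"
      using card\<Omega> by (metis card.empty card_insert_disjoint dvd_add_left_iff empty_iff finite.emptyI One_nat_def)
    then show False using p by simp
  qed
  obtain y where y: "y \<in> carrier Y" "X = W #>\<^bsub>Y\<^esub> y" using \<Omega>E[OF X(1)] by blast
  have "\<phi> g X = X" if "g \<in> carrier P" for g
  proof -
    have "X \<in> orbit P \<phi> X" "\<phi> g X \<in> orbit P \<phi> X"
      unfolding orbit_def using that \<phi>one[OF X(1)] P.one_closed by force+
    then show ?thesis using orbX by (metis card_1_singletonE singletonD)
  qed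
  then have "\<theta> g y \<in> W #>\<^bsub>Y\<^esub> y" if "g \<in> carrier P" for g
    using \<phi>coset[OF that y(1)] y that Y.rcos_self[OF \<theta>Y[OF that y(1)] W] by metis
  then have "\<theta> g y \<otimes>\<^bsub>Y\<^esub> inv\<^bsub>Y\<^esub> y \<in> W" if "g \<in> carrier P" for g
    using that y(1) W.mem_carrier unfolding r_coset_def by (fastforce simp: Y.m_assoc)
  moreover have "y \<notin> W"
    using X(2) y W by (metis Y.coset_join2)
  ultimately show ?thesis using y(1) by blast
qed

section \<open>Skew left braces\<close>

text \<open>
  The elements that a set of endomorphisms fixes modulo a normal subgroup \<open>N\<close>.
\<close>

lemma (in group) subgroup_moved_into_normal:
  assumes N: "N \<lhd> G" and \<Phi>: "\<And>f. f \<in> \<Phi> \<Longrightarrow> f \<in> hom G G"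
  shows "subgroup {x \<in> carrier G. \<forall>f \<in> \<Phi>. f x \<otimes> inv x \<in> N} G"
proof (rule subgroupI)
  interpret N: normal N G by (rule N)
  have f1: "f \<one> = \<one>" and fc: "x \<in> carrier G \<Longrightarrow> f x \<in> carrier G"
    and fm: "\<lbrakk>x \<in> carrier G; y \<in> carrier G\<rbrakk> \<Longrightarrow> f (x \<otimes> y) = f x \<otimes> f y"
    and fi: "x \<in> carrier G \<Longrightarrow> f (inv x) = inv (f x)" if "f \<in> \<Phi>" for f x y
  proof -
    interpret f: group_hom G G f using \<Phi>[OF that] by unfold_locales
    show "f \<one> = \<one>" by simp
    show "x \<in> carrier G \<Longrightarrow> f x \<in> carrier G" by simp
    show "\<lbrakk>x \<in> carrier G; y \<in> carrier G\<rbrakk> \<Longrightarrow> f (x \<otimes> y) = f x \<otimes> f y" by simp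
    show "x \<in> carrier G \<Longrightarrow> f (inv x) = inv (f x)" by simp
  qed
  let ?K = "{x \<in> carrier G. \<forall>f \<in> \<Phi>. f x \<otimes> inv x \<in> N}"
  show "?K \<subseteq> carrier G" by blast
  have "f \<one> \<otimes> inv \<one> \<in> N" if "f \<in> \<Phi>" for f
    unfolding f1[OF that] using N.one_closed by simp
  then show "?K \<noteq> {}" by blast
  show "inv x \<in> ?K" if "x \<in> ?K" for x
  proof -
    have x: "x \<in> carrier G" using that by blast
    have "f (inv x) \<otimes> inv (inv x) \<in> N" if f: "f \<in> \<Phi>" for f
    proof -
      have "inv x \<otimes> inv (f x \<otimes> inv x) \<otimes> x \<in> N"
        using \<open>x \<in> ?K\<close> f x N.inv_op_closed1 by auto
      then show ?thesis
        using x fc[OF f x] fi[OF f x] by (simp add: inv_mult_group m_assoc inv_mult_cancel)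
    qed
    then show ?thesis using x by simp
  qed
  show "x \<otimes> y \<in> ?K" if "x \<in> ?K" "y \<in> ?K" for x y
  proof -
    have x: "x \<in> carrier G" and y: "y \<in> carrier G" using that by blast+
    have "f (x \<otimes> y) \<otimes> inv (x \<otimes> y) \<in> N" if f: "f \<in> \<Phi>" for f
    proof -
      have "(f x \<otimes> inv x) \<otimes> (x \<otimes> (f y \<otimes> inv y) \<otimes> inv x) \<in> N"
        using \<open>x \<in> ?K\<close> \<open>y \<in> ?K\<close> f x N.inv_op_closed2 by auto
      then show ?thesis
        using x y fc[OF f x] fc[OF f y] fm[OF f x y]
        by (simp add: inv_mult_group m_assoc inv_mult_cancel)
    qed
    then show ?thesis using x y by simp
  qed
qed

lemma sequence_escapes:
  assumes "\<not> U 0 \<subseteq> F" "U (n::nat) \<subseteq> F"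
  obtains k where "\<not> U k \<subseteq> F" "U (Suc k) \<subseteq> F"
proof -
  have "\<not> (\<forall>k. \<not> U k \<subseteq> F \<longrightarrow> \<not> U (Suc k) \<subseteq> F)"
    using assms nat_induct[of "\<lambda>k. \<not> U k \<subseteq> F"] by blast
  then show thesis using that by blast
qed

text \<open>
  A skew left brace presented by its additive group \<open>A\<close>, written multiplicatively, its circle
  group \<open>H\<close> and the action \<open>act\<close> of \<open>H\<close> on \<open>A\<close>, usually called \<open>\<lambda>\<close>. Equality of the two identity
  elements is a consequence of these assumptions.
\<close>

locale skew_brace = group A + circ: group H
  for A :: "('a, 'b) monoid_scheme" (structure) and H :: "('a, 'c) monoid_scheme" +
  fixes act :: "'a \<Rightarrow> 'a \<Rightarrow> 'a"
  assumes carrier_circ: "carrier H = carrier A"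
    and act_hom: "g \<in> carrier A \<Longrightarrow> act g \<in> hom A A"
    and act_circ: "\<lbrakk>g \<in> carrier A; h \<in> carrier A; x \<in> carrier A\<rbrakk>
      \<Longrightarrow> act (g \<otimes>\<^bsub>H\<^esub> h) x = act g (act h x)"
    and circ_eq: "\<lbrakk>g \<in> carrier A; h \<in> carrier A\<rbrakk> \<Longrightarrow> g \<otimes>\<^bsub>H\<^esub> h = g \<otimes> act g h"
begin

lemma act_closed [simp]: "\<lbrakk>g \<in> carrier A; x \<in> carrier A\<rbrakk> \<Longrightarrow> act g x \<in> carrier A"
  using act_hom by (auto simp: hom_def)

lemma act_mult: "\<lbrakk>g \<in> carrier A; x \<in> carrier A; y \<in> carrier A\<rbrakk>
    \<Longrightarrow> act g (x \<otimes> y) = act g x \<otimes> act g y"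
  using act_hom by (auto simp: hom_def)

lemma act_group_hom: "g \<in> carrier A \<Longrightarrow> group_hom A A (act g)"
  using act_hom by unfold_locales

lemma act_one_right [simp]: "g \<in> carrier A \<Longrightarrow> act g \<one> = \<one>"
  using group_hom.hom_one[OF act_group_hom] .

lemma act_inv: "\<lbrakk>g \<in> carrier A; x \<in> carrier A\<rbrakk> \<Longrightarrow> act g (inv x) = inv (act g x)"
  using group_hom.hom_inv[OF act_group_hom] .

lemma circ_closed [simp]: "\<lbrakk>g \<in> carrier A; h \<in> carrier A\<rbrakk> \<Longrightarrow> g \<otimes>\<^bsub>H\<^esub> h \<in> carrier A"
  by (simp add: circ_eq)

lemma circ_inv_closed [simp]: "g \<in> carrier A \<Longrightarrow> inv\<^bsub>H\<^esub> g \<in> carrier A"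
  using circ.inv_closed carrier_circ by simp

lemma one_circ: "\<one>\<^bsub>H\<^esub> = \<one>"
proof -
  have o: "\<one>\<^bsub>H\<^esub> \<in> carrier A" using circ.one_closed carrier_circ by simp
  then have "\<one>\<^bsub>H\<^esub> \<otimes>\<^bsub>H\<^esub> \<one> = \<one>\<^bsub>H\<^esub>" by (simp add: circ_eq)
  then show ?thesis using circ.l_one[of \<one>] carrier_circ by simp
qed

lemma act_one [simp]: "x \<in> carrier A \<Longrightarrow> act \<one> x = x"
  using circ.l_one[of x] circ_eq[of \<one> x] carrier_circ one_circ by simp

lemma act_circ_inv [simp]:
  assumes "g \<in> carrier A" "x \<in> carrier A"
  shows "act g (act (inv\<^bsub>H\<^esub> g) x) = x" "act (inv\<^bsub>H\<^esub> g) (act g x) = x"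
  using act_circ[of g "inv\<^bsub>H\<^esub> g" x] act_circ[of "inv\<^bsub>H\<^esub> g" g x] assms
    circ.r_inv[of g] circ.l_inv[of g] carrier_circ one_circ by simp_all

text \<open>
  The terms of the left series: \<open>brace_series n\<close> is \<open>A\<^sup>n\<^sup>+\<^sup>1\<close>.
\<close>

primrec brace_series :: "nat \<Rightarrow> 'a set" where
  "brace_series 0 = carrier A"
| "brace_series (Suc n) =
     generate A {act h x \<otimes> inv x | h x. h \<in> carrier A \<and> x \<in> brace_series n}"

text \<open>
  The inner automorphisms of \<open>A\<close>.
\<close>

definition conj_maps :: "('a \<Rightarrow> 'a) set" where
  "conj_maps = (\<lambda>g x. g \<otimes> x \<otimes> inv g) ` carrier A"

text \<open>
  Generators of the group of automorphisms that the semidirect product of \<open>A\<close> and \<open>H\<close> induces on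
  \<open>A\<close>.
\<close>

definition all_maps :: "('a \<Rightarrow> 'a) set" where
  "all_maps = act ` carrier A \<union> conj_maps"

text \<open>
  The intersection with \<open>A\<close> of the upper central series of the semidirect product: an element is in
  the next term if the action and the conjugations move it only by elements of the present term.
\<close>

primrec hypercentre :: "nat \<Rightarrow> 'a set" where
  "hypercentre 0 = {\<one>}"
| "hypercentre (Suc n) = {x \<in> carrier A. \<forall>f \<in> all_maps. f x \<otimes> inv x \<in> hypercentre n}"

lemma conj_maps_hom: "f \<in> conj_maps \<Longrightarrow> f \<in> hom A A"
  unfolding conj_maps_def by (auto simp: hom_def m_assoc inv_mult_cancel)

lemma all_maps_hom: "f \<in> all_maps \<Longrightarrow> f \<in> hom A A"
  unfolding all_maps_def using conj_maps_hom act_hom by blast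

lemma hypercentre_normal_invariant:
  "hypercentre n \<lhd> A \<and> (\<forall>f \<in> all_maps. \<forall>x \<in> hypercentre n. f x \<in> hypercentre n)"
proof (induction n)
  case 0
  have "f \<one> = \<one>" if "f \<in> all_maps" for f
    using hom_one[OF all_maps_hom[OF that] is_group is_group] .
  then show ?case using one_is_normal by simp
next
  case (Suc n)
  interpret N: normal "hypercentre n" A using Suc by blast
  have sub: "subgroup (hypercentre (Suc n)) A"
    unfolding hypercentre.simps by (rule subgroup_moved_into_normal[OF _ all_maps_hom]) (use Suc in auto)
  have fc: "f x \<in> carrier A" if "f \<in> all_maps" "x \<in> carrier A" for f x
    using all_maps_hom[OF that(1)] that(2) by (auto simp: hom_def)
  have mono: "hypercentre n \<subseteq> hypercentre (Suc n)"
    using Suc N.mem_carrier by auto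
  have inv: "f x \<in> hypercentre (Suc n)" if f: "f \<in> all_maps" and x: "x \<in> hypercentre (Suc n)" for f x
  proof -
    have xc: "x \<in> carrier A" and "f x \<otimes> inv x \<in> hypercentre n" using x f by auto
    then have "(f x \<otimes> inv x) \<otimes> x \<in> hypercentre (Suc n)"
      using subgroup.m_closed[OF sub] mono x by blast
    then show ?thesis using fc[OF f xc] xc by (simp add: m_assoc del: hypercentre.simps)
  qed
  have "hypercentre (Suc n) \<lhd> A"
    using sub inv unfolding normal_inv_iff all_maps_def conj_maps_def by blast
  with inv show ?case by blast
qed

lemma hypercentre_normal: "hypercentre n \<lhd> A"
  using hypercentre_normal_invariant by blast

lemma hypercentre_act: "\<lbrakk>g \<in> carrier A; x \<in> hypercentre n\<rbrakk> \<Longrightarrow> act g x \<in> hypercentre n"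
  using hypercentre_normal_invariant unfolding all_maps_def by blast

lemma hypercentre_subgroup: "subgroup (hypercentre n) A"
  using hypercentre_normal normal_imp_subgroup by blast

lemma hypercentre_carrier: "x \<in> hypercentre n \<Longrightarrow> x \<in> carrier A"
  using subgroup.mem_carrier[OF hypercentre_subgroup] .

lemma hypercentre_Suc_mono: "hypercentre n \<subseteq> hypercentre (Suc n)"
proof
  fix x assume x: "x \<in> hypercentre n"
  have "f x \<otimes> inv x \<in> hypercentre n" if "f \<in> all_maps" for f
    using hypercentre_normal_invariant that x hypercentre_subgroup
    by (meson subgroup.m_closed subgroup.m_inv_closed)
  then show "x \<in> hypercentre (Suc n)" using hypercentre_carrier[OF x] by simp
qed

lemma hypercentre_SucD:
  assumes "x \<in> hypercentre (Suc n)" "g \<in> carrier A"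
  shows "act g x \<otimes> inv x \<in> hypercentre n" "g \<otimes> x \<otimes> inv g \<otimes> inv x \<in> hypercentre n"
  using assms by (auto simp: all_maps_def conj_maps_def)

lemma hypercentre_SucI:
  assumes "x \<in> carrier A" "\<And>g. g \<in> carrier A \<Longrightarrow> act g x \<otimes> inv x \<in> hypercentre n"
    "\<And>g. g \<in> carrier A \<Longrightarrow> g \<otimes> x \<otimes> inv g \<otimes> inv x \<in> hypercentre n"
  shows "x \<in> hypercentre (Suc n)"
  using assms by (auto simp: all_maps_def conj_maps_def)

text \<open>
  In a finite group an ascending series that grows until it reaches the whole group does reach it.
\<close>

lemma hypercentre_exhausts:
  assumes fin: "finite (carrier A)"
    and grow: "\<And>n. hypercentre n \<noteq> carrier A \<Longrightarrow> \<exists>x \<in> hypercentre (Suc n). x \<notin> hypercentre n"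
  shows "\<exists>m. hypercentre m = carrier A"
proof (rule ccontr)
  assume neg: "\<nexists>m. hypercentre m = carrier A"
  have finh: "finite (hypercentre n)" for n
    using fin hypercentre_carrier by (meson finite_subset subsetI)
  have "n \<le> card (hypercentre n)" for n
  proof (induction n)
    case (Suc n)
    have "hypercentre n \<subset> hypercentre (Suc n)"
      using hypercentre_Suc_mono[of n] grow[of n] neg by blast
    then have "card (hypercentre n) < card (hypercentre (Suc n))"
      using finh psubset_card_mono by blast
    with Suc show ?case by linarith
  qed simp
  moreover have "card (hypercentre n) \<le> card (carrier A)" for n
    using fin hypercentre_carrier by (meson card_mono subsetI)
  ultimately show False by (meson Suc_n_not_le_n order_trans)
qed

text \<open>
  The preimage of the centre of the quotient of \<open>A\<close> by \<open>hypercentre n\<close>.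
\<close>

definition central_mod :: "nat \<Rightarrow> 'a set" where
  "central_mod n = {x \<in> carrier A. \<forall>f \<in> conj_maps. f x \<otimes> inv x \<in> hypercentre n}"

lemma central_mod_subgroup: "subgroup (central_mod n) A"
  unfolding central_mod_def by (rule subgroup_moved_into_normal[OF hypercentre_normal conj_maps_hom])

lemma central_modD:
  "\<lbrakk>x \<in> central_mod n; g \<in> carrier A\<rbrakk> \<Longrightarrow> g \<otimes> x \<otimes> inv g \<otimes> inv x \<in> hypercentre n"
  unfolding central_mod_def conj_maps_def by auto

lemma central_modI:
  assumes "x \<in> carrier A" "\<And>g. g \<in> carrier A \<Longrightarrow> g \<otimes> x \<otimes> inv g \<otimes> inv x \<in> hypercentre n"
  shows "x \<in> central_mod n"
  using assms unfolding central_mod_def conj_maps_def by auto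

lemma central_mod_carrier: "x \<in> central_mod n \<Longrightarrow> x \<in> carrier A"
  unfolding central_mod_def by blast

lemma central_mod_act:
  assumes h: "h \<in> carrier A" and x: "x \<in> central_mod n"
  shows "act h x \<in> central_mod n"
proof (rule central_modI)
  have xc: "x \<in> carrier A" using central_mod_carrier[OF x] .
  then show "act h x \<in> carrier A" using h by simp
  fix g assume g: "g \<in> carrier A"
  let ?g = "act (inv\<^bsub>H\<^esub> h) g"
  have "act h (?g \<otimes> x \<otimes> inv ?g \<otimes> inv x) \<in> hypercentre n"
    using hypercentre_act[OF h central_modD[OF x]] h g by simp
  then show "g \<otimes> act h x \<otimes> inv g \<otimes> inv (act h x) \<in> hypercentre n"
    using h g xc by (simp add: act_mult act_inv)
qed

lemma central_mod_not_subset: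
  assumes nil: "nilpotent_group A" and ne: "hypercentre n \<noteq> carrier A"
  shows "\<not> central_mod n \<subseteq> hypercentre n"
proof -
  interpret N: normal "hypercentre n" A by (rule hypercentre_normal)
  obtain c where c: "lower_central_series A c = {\<one>}"
    using nil unfolding nilpotent_group_def by blast
  have "\<not> lower_central_series A 0 \<subseteq> hypercentre n" "lower_central_series A c \<subseteq> hypercentre n"
    using ne N.subset N.one_closed c by auto
  then obtain k where k: "\<not> lower_central_series A k \<subseteq> hypercentre n"
    "lower_central_series A (Suc k) \<subseteq> hypercentre n"
    by (rule sequence_escapes)
  have "lower_central_series A k \<subseteq> central_mod n"
  proof
    fix x assume x: "x \<in> lower_central_series A k"
    have xc: "x \<in> carrier A"
      using subgroup.mem_carrier[OF lower_central_series_subgroup[OF is_group] x] .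
    show "x \<in> central_mod n"
    proof (rule central_modI[OF xc])
      fix g assume g: "g \<in> carrier A"
      have "inv (x \<otimes> g \<otimes> inv x \<otimes> inv g) \<in> hypercentre n"
        using lower_central_series_commutator[OF x g] k(2) N.m_inv_closed by blast
      then show "g \<otimes> x \<otimes> inv g \<otimes> inv x \<in> hypercentre n"
        using xc g by (simp add: inv_mult_group m_assoc)
    qed
  qed
  with k(1) show ?thesis by blast
qed

subsection \<open>Left nilpotency and the hypercentre\<close>

lemma hypercentre_exhausts_if_brace_series_trivial:
  assumes fin: "finite (carrier A)" and nil: "nilpotent_group A"
    and triv: "brace_series c = {\<one>}"
  shows "\<exists>m. hypercentre m = carrier A"
proof (rule hypercentre_exhausts[OF fin])
  fix n assume "hypercentre n \<noteq> carrier A"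
  then have Z: "\<not> central_mod n \<subseteq> hypercentre n"
    by (rule central_mod_not_subset[OF nil])
  interpret N: normal "hypercentre n" A by (rule hypercentre_normal)
  interpret Z: subgroup "central_mod n" A by (rule central_mod_subgroup)
  \<comment> \<open>Iterated differences starting from \<open>central_mod n\<close>. They lie in the left series, so they
    end in \<open>hypercentre n\<close>; the last set that does not lie in it provides the new element.\<close>
  define U where "U = rec_nat (central_mod n) (\<lambda>_ X. {act h x \<otimes> inv x | h x. h \<in> carrier A \<and> x \<in> X})"
  have U0: "U 0 = central_mod n"
    and USuc: "U (Suc k) = {act h x \<otimes> inv x | h x. h \<in> carrier A \<and> x \<in> U k}" for k
    unfolding U_def by simp_all
  have UZ: "U k \<subseteq> central_mod n" for k
    by (induction k) (auto simp: U0 USuc intro!: central_mod_act)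
  have Ub: "U k \<subseteq> brace_series k" for k
  proof (induction k)
    case 0
    show ?case using U0 Z.subset by simp
  next
    case (Suc k)
    then show ?case unfolding USuc by (auto intro!: generate.incl)
  qed
  have "U c \<subseteq> hypercentre n" using Ub[of c] triv N.one_closed by auto
  then obtain k where k: "\<not> U k \<subseteq> hypercentre n" "U (Suc k) \<subseteq> hypercentre n"
    using sequence_escapes[of U] Z U0 by metis
  then obtain x where x: "x \<in> U k" "x \<notin> hypercentre n" by blast
  have "x \<in> hypercentre (Suc n)"
  proof (rule hypercentre_SucI)
    show "x \<in> carrier A" using x(1) UZ Z.mem_carrier by blast
    show "act g x \<otimes> inv x \<in> hypercentre n" if "g \<in> carrier A" for g
      using k(2) x(1) that unfolding USuc by blast
    show "g \<otimes> x \<otimes> inv g \<otimes> inv x \<in> hypercentre n" if "g \<in> carrier A" for g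
      using central_modD that x(1) UZ by blast
  qed
  with x(2) show "\<exists>x \<in> hypercentre (Suc n). x \<notin> hypercentre n" by blast
qed

lemma brace_series_trivial_if_hypercentre_exhausts:
  assumes "hypercentre m = carrier A"
  shows "brace_series m = {\<one>}"
proof -
  have "brace_series n \<subseteq> hypercentre (m - n)" if "n \<le> m" for n
    using that
  proof (induction n)
    case 0
    show ?case using assms by simp
  next
    case (Suc n)
    have eq: "m - n = Suc (m - Suc n)" using Suc.prems by simp
    show ?case
      unfolding brace_series.simps
    proof (rule generate_subgroup_incl[OF _ hypercentre_subgroup], safe)
      fix h x assume "h \<in> carrier A" "x \<in> brace_series n"
      then show "act h x \<otimes> inv x \<in> hypercentre (m - Suc n)"
        using hypercentre_SucD(1)[of x "m - Suc n" h] Suc eq by auto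
    qed
  qed
  from this[of m] have "brace_series m \<subseteq> {\<one>}" by simp
  moreover have "\<one> \<in> brace_series m" by (cases m) (auto intro: generate.one)
  ultimately show ?thesis by blast
qed

end

context skew_brace
begin

text \<open>
  The inverse of \<open>x\<close> in the circle group is \<open>act (inv\<^bsub>H\<^esub> x) (inv x)\<close>.
\<close>

lemma circ_subgroup_if_act_invariant:
  assumes K: "subgroup K A" and inv: "\<And>g x. \<lbrakk>g \<in> carrier A; x \<in> K\<rbrakk> \<Longrightarrow> act g x \<in> K"
  shows "subgroup K H"
proof -
  interpret K: subgroup K A by (rule K)
  show ?thesis
  proof (rule circ.subgroupI)
    show "K \<subseteq> carrier H" using K.subset carrier_circ by simp
    show "K \<noteq> {}" using K.one_closed by blast
    show "x \<otimes>\<^bsub>H\<^esub> y \<in> K" if "x \<in> K" "y \<in> K" for x y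
      using that inv circ_eq by (simp add: K.mem_carrier)
    show "inv\<^bsub>H\<^esub> x \<in> K" if x: "x \<in> K" for x
    proof -
      have xc: "x \<in> carrier A" using K.mem_carrier[OF x] .
      have "x \<otimes> act x (inv\<^bsub>H\<^esub> x) = \<one>"
        using circ_eq[OF xc circ_inv_closed[OF xc]] circ.r_inv[of x] xc carrier_circ one_circ by simp
      then have "act x (inv\<^bsub>H\<^esub> x) = inv x"
        using xc by (metis act_closed circ_inv_closed inv_comm inv_equality)
      then have "inv\<^bsub>H\<^esub> x = act (inv\<^bsub>H\<^esub> x) (inv x)"
        using act_circ_inv(2)[OF xc circ_inv_closed[OF xc]] by simp
      then show ?thesis using inv[of "inv\<^bsub>H\<^esub> x" "inv x"] xc x by simp
    qed
  qed
qed

subsection \<open>Nilpotency of the circle group\<close>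

text \<open>
  The elements of the circle group whose action lowers the hypercentral filtration by \<open>i\<close> steps.
\<close>

definition lowering :: "nat \<Rightarrow> 'a set" where
  "lowering i = {h \<in> carrier A. \<forall>j. \<forall>x \<in> hypercentre (i + j). act h x \<otimes> inv x \<in> hypercentre j}"

lemma loweringD: "\<lbrakk>h \<in> lowering i; x \<in> hypercentre (i + j)\<rbrakk> \<Longrightarrow> act h x \<otimes> inv x \<in> hypercentre j"
  unfolding lowering_def by blast

lemma lowering_carrier: "h \<in> lowering i \<Longrightarrow> h \<in> carrier A"
  unfolding lowering_def by blast

lemma lowering_subgroup: "subgroup (lowering i) H"
proof (rule circ.subgroupI)
  show "lowering i \<subseteq> carrier H" using lowering_carrier carrier_circ by blast
  have "\<one> \<in> lowering i"
    unfolding lowering_def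
    using hypercentre_carrier subgroup.one_closed[OF hypercentre_subgroup] by simp
  then show "lowering i \<noteq> {}" by blast
  show "inv\<^bsub>H\<^esub> h \<in> lowering i" if h: "h \<in> lowering i" for h
    unfolding lowering_def
  proof (intro CollectI conjI allI ballI)
    have hc: "h \<in> carrier A" using lowering_carrier[OF h] .
    show "inv\<^bsub>H\<^esub> h \<in> carrier A" using hc by simp
    fix j x assume x: "x \<in> hypercentre (i + j)"
    have xc: "x \<in> carrier A" using hypercentre_carrier[OF x] .
    let ?y = "act (inv\<^bsub>H\<^esub> h) x"
    have "act h ?y \<otimes> inv ?y \<in> hypercentre j"
      using loweringD[OF h hypercentre_act[OF _ x]] hc by simp
    then have "inv (act h ?y \<otimes> inv ?y) \<in> hypercentre j"
      by (rule subgroup.m_inv_closed[OF hypercentre_subgroup])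
    then show "?y \<otimes> inv x \<in> hypercentre j"
      using hc xc by (simp add: inv_mult_group)
  qed
  show "h \<otimes>\<^bsub>H\<^esub> k \<in> lowering i" if h: "h \<in> lowering i" and k: "k \<in> lowering i" for h k
    unfolding lowering_def
  proof (intro CollectI conjI allI ballI)
    have hc: "h \<in> carrier A" and kc: "k \<in> carrier A" using lowering_carrier h k by blast+
    show "h \<otimes>\<^bsub>H\<^esub> k \<in> carrier A" using hc kc by simp
    fix j x assume x: "x \<in> hypercentre (i + j)"
    have xc: "x \<in> carrier A" using hypercentre_carrier[OF x] .
    let ?y = "act k x"
    have "(act h ?y \<otimes> inv ?y) \<otimes> (?y \<otimes> inv x) \<in> hypercentre j"
      using loweringD[OF h hypercentre_act[OF kc x]] loweringD[OF k x]
      by (rule subgroup.m_closed[OF hypercentre_subgroup])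
    then show "act (h \<otimes>\<^bsub>H\<^esub> k) x \<otimes> inv x \<in> hypercentre j"
      using hc kc xc by (simp add: act_circ m_assoc inv_mult_cancel)
  qed
qed

lemma lowering_commutator:
  assumes h: "h \<in> lowering i" and g: "g \<in> carrier A"
  shows "h \<otimes>\<^bsub>H\<^esub> g \<otimes>\<^bsub>H\<^esub> inv\<^bsub>H\<^esub> h \<otimes>\<^bsub>H\<^esub> inv\<^bsub>H\<^esub> g \<in> lowering (Suc i)" (is "?c \<in> _")
  unfolding lowering_def
proof (intro CollectI conjI allI ballI)
  have hc: "h \<in> carrier A" using lowering_carrier[OF h] .
  show cc: "?c \<in> carrier A" using hc g by simp
  fix j x assume x: "x \<in> hypercentre (Suc i + j)"
  have xc: "x \<in> carrier A" using hypercentre_carrier[OF x] .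
  interpret N: normal "hypercentre j" A by (rule hypercentre_normal)
  define y where "y = act (inv\<^bsub>H\<^esub> (g \<otimes>\<^bsub>H\<^esub> h)) x"
  have yc: "y \<in> carrier A" unfolding y_def using g hc xc by simp
  have y: "y \<in> hypercentre (Suc (i + j))"
    unfolding y_def using hypercentre_act[OF _ x] g hc by simp
  have x_eq: "x = act g (act h y)"
    unfolding y_def using act_circ_inv(1)[of "g \<otimes>\<^bsub>H\<^esub> h" x]
      act_circ[of g h "act (inv\<^bsub>H\<^esub> (g \<otimes>\<^bsub>H\<^esub> h)) x"] g hc xc by simp
  have "?c \<otimes>\<^bsub>H\<^esub> (g \<otimes>\<^bsub>H\<^esub> h) = h \<otimes>\<^bsub>H\<^esub> g"
    using g hc carrier_circ by (simp add: circ.m_assoc circ.inv_mult_cancel)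
  then have cx_eq: "act ?c x = act h (act g y)"
    unfolding x_eq using cc g hc yc by (metis act_circ circ_closed)
  define u where "u = act g y \<otimes> inv y"
  define v where "v = act h y \<otimes> inv y"
  have uc: "u \<in> carrier A" and vc: "v \<in> carrier A"
    unfolding u_def v_def using g hc yc by simp_all
  have u: "u \<in> hypercentre (i + j)"
    unfolding u_def by (rule hypercentre_SucD(1)[OF y g])
  have v: "v \<in> hypercentre (Suc j)"
    unfolding v_def using loweringD[OF h, of y "Suc j"] y by simp
  have gy: "act g y = u \<otimes> y" and hy: "act h y = v \<otimes> y"
    unfolding u_def v_def using g hc yc by (simp_all add: m_assoc)
  define u' where "u' = act h u \<otimes> inv u"
  define v' where "v' = act g v \<otimes> inv v"
  have u'c: "u' \<in> carrier A" and v'c: "v' \<in> carrier A"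
    unfolding u'_def v'_def using g hc uc vc by simp_all
  have u': "u' \<in> hypercentre j" unfolding u'_def by (rule loweringD[OF h u])
  have v': "v' \<in> hypercentre j" unfolding v'_def by (rule hypercentre_SucD(1)[OF v g])
  have hu: "act h u = u' \<otimes> u" and gv: "act g v = v' \<otimes> v"
    unfolding u'_def v'_def using g hc uc vc by (simp_all add: m_assoc)
  \<comment> \<open>Up to the factors \<open>u'\<close> and \<open>v'\<close> from \<open>hypercentre j\<close>, the images of \<open>y\<close> under the two orders
    of composition differ by the commutator of \<open>u\<close> and \<open>v\<close>, and \<open>v\<close> is central modulo \<open>hypercentre j\<close>.\<close>
  have "act ?c x = u' \<otimes> u \<otimes> (v \<otimes> y)"
    unfolding cx_eq gy using hc uc yc by (simp add: act_mult hu hy)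
  moreover have "x = v' \<otimes> v \<otimes> (u \<otimes> y)"
    unfolding x_eq hy using g vc yc by (simp add: act_mult gv gy)
  ultimately have "act ?c x \<otimes> inv x = u' \<otimes> (u \<otimes> v \<otimes> inv u \<otimes> inv v) \<otimes> inv v'"
    using uc vc u'c v'c yc by (simp add: m_assoc inv_mult_group inv_mult_cancel)
  then show "act ?c x \<otimes> inv x \<in> hypercentre j"
    using u' v' hypercentre_SucD(2)[OF v uc] by simp
qed

lemma circ_lower_central_series_lowering: "lower_central_series H i \<subseteq> lowering i"
proof (induction i)
  case 0
  show ?case
    unfolding lowering_def
    using hypercentre_act carrier_circ hypercentre_subgroup hypercentre_carrier
    by (auto intro!: subgroup.m_closed[OF hypercentre_subgroup] subgroup.m_inv_closed[OF hypercentre_subgroup])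
next
  case (Suc i)
  show ?case
    by (rule lower_central_series_SucI[OF circ.is_group lowering_subgroup])
      (use Suc lowering_commutator carrier_circ in blast)
qed

text \<open>
  On the kernel of the action the circle operation agrees with the operation of \<open>A\<close>, and a
  conjugate in the circle group is the image under the action, conjugated in \<open>A\<close>. Hence
  commutators with elements of the kernel descend along the hypercentral filtration.
\<close>

lemma circ_lower_central_series_kernel:
  assumes m: "hypercentre m = carrier A" and j: "j \<le> m"
  shows "lower_central_series H (m + j) \<subseteq> {k \<in> hypercentre (m - j). \<forall>x \<in> carrier A. act k x = x}"
  using j
proof (induction j)
  case 0
  have "act k x = x" if "k \<in> lower_central_series H m" "x \<in> carrier A" for k x
  proof -
    have k: "k \<in> lowering m" using circ_lower_central_series_lowering that(1) by blast
    then have "act k x \<otimes> inv x = \<one>"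
      using loweringD[of k m x 0] m that(2) by simp
    then show ?thesis
      using lowering_carrier[OF k] that(2) by (metis act_closed inv_equality inv_closed inv_inv)
  qed
  moreover have "lower_central_series H m \<subseteq> carrier A"
    using circ_lower_central_series_lowering lowering_carrier by blast
  ultimately show ?case using m by auto
next
  case (Suc j)
  let ?i = "m - Suc j"
  have eq: "m - j = Suc ?i" using Suc.prems by simp
  interpret N: normal "hypercentre ?i" A by (rule hypercentre_normal)
  define K where "K i = {k \<in> hypercentre i. \<forall>x \<in> carrier A. act k x = x}" for i
  have IH: "lower_central_series H (m + j) \<subseteq> K (Suc ?i)"
    using Suc unfolding K_def eq by simp
  have K_circ: "k \<otimes>\<^bsub>H\<^esub> x = k \<otimes> x" if "k \<in> K i" "x \<in> carrier A" for k x i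
    using that hypercentre_carrier[of k i] circ_eq[of k x] unfolding K_def by auto
  have K_inv: "inv\<^bsub>H\<^esub> k = inv k" if "k \<in> K i" for k i
  proof -
    have kc: "k \<in> carrier A" using that hypercentre_carrier unfolding K_def by blast
    then have "k \<otimes>\<^bsub>H\<^esub> inv k = \<one>\<^bsub>H\<^esub>" using K_circ[OF that, of "inv k"] one_circ by simp
    then show ?thesis using kc carrier_circ by (metis circ.inv_equality circ.inv_comm inv_closed)
  qed
  have act_K_inv: "act (inv\<^bsub>H\<^esub> k) x = x" if "k \<in> K i" "x \<in> carrier A" for k x i
    using that act_circ_inv(2)[of k x] hypercentre_carrier unfolding K_def by auto
  have sub: "subgroup (K ?i) H"
  proof (rule circ.subgroupI)
    show "K ?i \<subseteq> carrier H" using N.subset carrier_circ unfolding K_def by auto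
    have "\<one> \<in> K ?i" unfolding K_def by simp
    then show "K ?i \<noteq> {}" by blast
    show "inv\<^bsub>H\<^esub> k \<in> K ?i" if "k \<in> K ?i" for k
      using that act_K_inv[OF that] K_inv[OF that] unfolding K_def by simp
    show "k \<otimes>\<^bsub>H\<^esub> l \<in> K ?i" if "k \<in> K ?i" "l \<in> K ?i" for k l
    proof -
      have "k \<in> carrier A" "l \<in> carrier A" using that N.mem_carrier unfolding K_def by blast+
      moreover have "k \<otimes>\<^bsub>H\<^esub> l = k \<otimes> l" using K_circ[OF that(1)] calculation by simp
      ultimately show ?thesis using that act_circ[of k l] unfolding K_def by (auto simp: N.m_closed)
    qed
  qed
  have "lower_central_series H (Suc (m + j)) \<subseteq> K ?i"
  proof (rule lower_central_series_SucI[OF circ.is_group sub])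
    fix k g assume "k \<in> lower_central_series H (m + j)" and g': "g \<in> carrier H"
    then have k: "k \<in> K (Suc ?i)" using IH by blast
    have kc: "k \<in> carrier A" using k hypercentre_carrier unfolding K_def by blast
    have g: "g \<in> carrier A" using g' carrier_circ by simp
    define l where "l = inv k"
    have lc: "l \<in> carrier A" unfolding l_def using kc by simp
    have l: "l \<in> hypercentre (Suc ?i)"
      unfolding l_def using k subgroup.m_inv_closed[OF hypercentre_subgroup] unfolding K_def by blast
    have l_inv: "inv\<^bsub>H\<^esub> k = l" unfolding l_def by (rule K_inv[OF k])
    define c where "c = g \<otimes>\<^bsub>H\<^esub> l \<otimes>\<^bsub>H\<^esub> inv\<^bsub>H\<^esub> g"
    have cc: "c \<in> carrier A" unfolding c_def using g lc by simp
    have act_c: "act c x = x" if "x \<in> carrier A" for x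
      unfolding c_def using g lc that act_K_inv[OF k, unfolded l_inv] by (simp add: act_circ)
    have "c \<otimes> g = c \<otimes>\<^bsub>H\<^esub> g" using cc g act_c by (simp add: circ_eq)
    also have "\<dots> = g \<otimes> act g l"
      unfolding c_def using g lc carrier_circ by (simp add: circ.m_assoc circ_eq[of g l, symmetric])
    finally have c_eq: "c = g \<otimes> act g l \<otimes> inv g"
      using cc g lc by (metis act_closed inv_solve_right m_closed)
    define w where "w = act g l \<otimes> inv l"
    have w: "w \<in> hypercentre ?i" unfolding w_def by (rule hypercentre_SucD(1)[OF l g])
    have wc: "w \<in> carrier A" using N.mem_carrier[OF w] .
    have "act g l = w \<otimes> l" unfolding w_def using g lc by (simp add: m_assoc)
    then have c_eq': "c = ((g \<otimes> w \<otimes> inv g) \<otimes> (g \<otimes> l \<otimes> inv g \<otimes> inv l)) \<otimes> l"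
      unfolding c_eq using g lc wc by (simp add: m_assoc inv_mult_cancel)
    have f: "(g \<otimes> w \<otimes> inv g) \<otimes> (g \<otimes> l \<otimes> inv g \<otimes> inv l) \<in> hypercentre ?i" (is "?f \<in> _")
      using N.inv_op_closed2[OF g w] hypercentre_SucD(2)[OF l g] by simp
    have comm_eq: "k \<otimes>\<^bsub>H\<^esub> g \<otimes>\<^bsub>H\<^esub> inv\<^bsub>H\<^esub> k \<otimes>\<^bsub>H\<^esub> inv\<^bsub>H\<^esub> g = k \<otimes>\<^bsub>H\<^esub> c"
      unfolding c_def l_inv using g kc lc carrier_circ by (simp add: circ.m_assoc)
    also have kc_eq: "k \<otimes>\<^bsub>H\<^esub> c = k \<otimes> c" by (rule K_circ[OF k cc])
    also have "k \<otimes> c = k \<otimes> ?f \<otimes> inv k"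
      unfolding c_eq' l_def using kc g w wc by (simp add: m_assoc)
    finally have "k \<otimes>\<^bsub>H\<^esub> g \<otimes>\<^bsub>H\<^esub> inv\<^bsub>H\<^esub> k \<otimes>\<^bsub>H\<^esub> inv\<^bsub>H\<^esub> g \<in> hypercentre ?i"
      using N.inv_op_closed2[OF kc f] by simp
    moreover have "act (k \<otimes>\<^bsub>H\<^esub> c) x = x" if "x \<in> carrier A" for x
      using act_circ[OF kc cc that] act_c[OF that] k that unfolding K_def by simp
    ultimately show "k \<otimes>\<^bsub>H\<^esub> g \<otimes>\<^bsub>H\<^esub> inv\<^bsub>H\<^esub> k \<otimes>\<^bsub>H\<^esub> inv\<^bsub>H\<^esub> g \<in> K ?i"
      unfolding K_def comm_eq by blast
  qed
  then show ?case unfolding K_def by simp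
qed

lemma circ_nilpotent_if_hypercentre_exhausts:
  assumes "hypercentre m = carrier A"
  shows "nilpotent_group H"
proof -
  have "lower_central_series H (m + m) \<subseteq> {\<one>\<^bsub>H\<^esub>}"
    using circ_lower_central_series_kernel[OF assms order_refl] one_circ by auto
  then have "lower_central_series H (m + m) = {\<one>\<^bsub>H\<^esub>}"
    using subgroup.one_closed[OF lower_central_series_subgroup[OF circ.is_group]] by blast
  then show ?thesis unfolding nilpotent_group_def using circ.is_group by blast
qed

subsection \<open>The primary components\<close>

lemma p_torsion_act:
  assumes g: "g \<in> carrier A" and x: "x \<in> p_torsion A p"
  shows "act g x \<in> p_torsion A p"
proof -
  interpret f: group_hom A A "act g" by (rule act_group_hom[OF g])
  have "x \<in> carrier A" "x [^] (p ^ multiplicity p (order A)) = \<one>"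
    using x unfolding p_torsion_def by auto
  then show ?thesis
    unfolding p_torsion_def using g f.hom_nat_pow[of x] by (metis (mono_tags, lifting) act_closed f.hom_one mem_Collect_eq)
qed

lemma p_torsion_act_trivial:
  assumes fin: "finite (carrier A)" and nilA: "nilpotent_group A" and nilH: "nilpotent_group H"
    and p: "prime p" and q: "prime q" and pq: "p \<noteq> q"
    and a: "a \<in> p_torsion A p" and b: "b \<in> p_torsion A q"
  shows "act b a = a"
proof -
  have co: "coprime (p ^ multiplicity p (order A)) (q ^ multiplicity q (order A))"
    using primes_coprime[OF p q pq] by simp
  have sub: "subgroup (p_torsion A r) A" if "prime r" for r
    using nilpotent_group_p_torsion(1)[OF nilA fin that] normal_imp_subgroup by blast
  have circ_pow: "x [^]\<^bsub>H\<^esub> (r ^ multiplicity r (order A)) = \<one>\<^bsub>H\<^esub>" if r: "prime r" and x: "x \<in> p_torsion A r" for r x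
  proof -
    have "subgroup (p_torsion A r) H"
      by (rule circ_subgroup_if_act_invariant[OF sub[OF r] p_torsion_act])
    from circ.pow_card_subgroup_eq_one[OF this x] show ?thesis
      using nilpotent_group_p_torsion(2)[OF nilA fin r] by simp
  qed
  have ac: "a \<in> carrier A" and bc: "b \<in> carrier A" using a b unfolding p_torsion_def by auto
  define u where "u = act a b"
  define v where "v = act b a"
  have u: "u \<in> p_torsion A q" and v: "v \<in> p_torsion A p"
    unfolding u_def v_def using p_torsion_act a b ac bc by auto
  have uc: "u \<in> carrier A" and vc: "v \<in> carrier A" unfolding u_def v_def using ac bc by auto
  have "a \<otimes>\<^bsub>H\<^esub> b = b \<otimes>\<^bsub>H\<^esub> a"
    by (rule nilpotent_group_commute_if_coprime_pow_eq_one[OF nilH _ _ circ_pow[OF p a] circ_pow[OF q b] co])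
      (use ac bc carrier_circ in auto)
  then have "a \<otimes> u = b \<otimes> v"
    unfolding u_def v_def using ac bc by (simp add: circ_eq)
  also have "b \<otimes> v = v \<otimes> b"
    by (rule nilpotent_group_commute_if_coprime_pow_eq_one[OF nilA vc bc _ _ co, symmetric])
      (use v b in \<open>auto simp: p_torsion_def\<close>)
  \<comment> \<open>The left side has \<open>p\<close>-power order and the right side \<open>q\<close>-power order, so both are trivial.\<close>
  finally have eq: "inv v \<otimes> a = b \<otimes> inv u"
    using ac bc uc vc by (metis inv_closed inv_solve_left inv_solve_right m_assoc m_closed)
  have "inv v \<otimes> a \<in> p_torsion A p"
    using sub[OF p] a v by (meson subgroup.m_closed subgroup.m_inv_closed)
  moreover have "b \<otimes> inv u \<in> p_torsion A q"
    using sub[OF q] b u by (meson subgroup.m_closed subgroup.m_inv_closed)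
  ultimately have t: "(inv v \<otimes> a) [^] (p ^ multiplicity p (order A)) = \<one>"
    "(inv v \<otimes> a) [^] (q ^ multiplicity q (order A)) = \<one>"
    unfolding eq p_torsion_def by auto
  have tc: "inv v \<otimes> a \<in> carrier A" using vc ac by simp
  have "ord (inv v \<otimes> a) = 1"
    using t co pow_eq_id[OF tc] by (meson coprime_common_divisor_nat)
  then have "inv v \<otimes> a = \<one>" using ord_eq_1[OF tc] by simp
  then show ?thesis
    unfolding v_def[symmetric] using ac vc by (metis inv_equality inv_inv inv_closed)
qed

lemma hypercentre_exhausts_if_circ_nilpotent:
  assumes fin: "finite (carrier A)" and nilA: "nilpotent_group A" and nilH: "nilpotent_group H"
  shows "\<exists>m. hypercentre m = carrier A"
proof (rule hypercentre_exhausts[OF fin])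
  fix n assume "hypercentre n \<noteq> carrier A"
  then have "\<not> central_mod n \<subseteq> hypercentre n"
    by (rule central_mod_not_subset[OF nilA])
  then obtain p where p: "prime p" and Zp: "\<not> central_mod n \<inter> p_torsion A p \<subseteq> hypercentre n"
    using subgroup_subset_if_p_torsion_subset[OF fin central_mod_subgroup hypercentre_subgroup] by blast
  have tors: "subgroup (p_torsion A q) A" "card (p_torsion A q) = q ^ multiplicity q (order A)"
    "subgroup (p_torsion A q) H" if "prime q" for q
  proof -
    show "subgroup (p_torsion A q) A" "card (p_torsion A q) = q ^ multiplicity q (order A)"
      using nilpotent_group_p_torsion[OF nilA fin that] normal_imp_subgroup by blast+
    then show "subgroup (p_torsion A q) H"
      using circ_subgroup_if_act_invariant p_torsion_act by blast
  qed
  let ?P = "p_torsion A p" and ?Y = "central_mod n \<inter> p_torsion A p" and ?F = "hypercentre n"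
  have Y: "subgroup ?Y A" by (rule subgroups_Inter_pair[OF central_mod_subgroup tors(1)[OF p]])
  have W: "subgroup (?Y \<inter> ?F) (A\<lparr>carrier := ?Y\<rparr>)"
    by (rule subgroup_incl[OF subgroups_Inter_pair[OF Y hypercentre_subgroup] Y]) blast
  have Pc: "?P \<subseteq> carrier A" and Yc: "?Y \<subseteq> carrier A" unfolding p_torsion_def by auto
  have actY: "act g y \<in> ?Y" if "g \<in> carrier A" "y \<in> ?Y" for g y
    using that central_mod_act p_torsion_act by blast
  have "card ?Y dvd p ^ multiplicity p (order A)"
    using card_subgroup_dvd[OF Y tors(1)[OF p]] tors(2)[OF p] by simp
  then obtain b where b: "card ?Y = p ^ b"
    using divides_primepow_nat[OF p] by blast
  have "\<exists>y \<in> carrier (A\<lparr>carrier := ?Y\<rparr>) - (?Y \<inter> ?F). \<forall>g \<in> carrier (H\<lparr>carrier := ?P\<rparr>).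
      act g y \<otimes>\<^bsub>A\<lparr>carrier := ?Y\<rparr>\<^esub> inv\<^bsub>A\<lparr>carrier := ?Y\<rparr>\<^esub> y \<in> ?Y \<inter> ?F"
  proof (rule p_group_fixed_coset[OF circ.subgroup_imp_group[OF tors(3)[OF p]] subgroup_imp_group[OF Y] p _ _ W])
    show "order (H\<lparr>carrier := ?P\<rparr>) = p ^ multiplicity p (order A)"
      using tors(2)[OF p] by (simp add: order_def)
    show "order (A\<lparr>carrier := ?Y\<rparr>) = p ^ b" using b by (simp add: order_def)
    show "?Y \<inter> ?F \<noteq> carrier (A\<lparr>carrier := ?Y\<rparr>)" using Zp by auto
    fix g assume "g \<in> carrier (H\<lparr>carrier := ?P\<rparr>)"
    then have gc: "g \<in> carrier A" using Pc by auto
    show "act g \<in> hom (A\<lparr>carrier := ?Y\<rparr>) (A\<lparr>carrier := ?Y\<rparr>)"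
      using gc actY[OF gc] Yc by (auto simp: hom_def act_mult subset_iff)
    show "act g w \<in> ?Y \<inter> ?F" if "w \<in> ?Y \<inter> ?F" for w
      using that actY[OF gc] hypercentre_act[OF gc] by blast
    show "act (g \<otimes>\<^bsub>H\<lparr>carrier := ?P\<rparr>\<^esub> h) y = act g (act h y)"
      if "h \<in> carrier (H\<lparr>carrier := ?P\<rparr>)" "y \<in> carrier (A\<lparr>carrier := ?Y\<rparr>)" for h y
      using that gc Pc Yc by (auto simp: subset_iff intro!: act_circ)
  next
    show "act \<one>\<^bsub>H\<lparr>carrier := ?P\<rparr>\<^esub> y = y" if "y \<in> carrier (A\<lparr>carrier := ?Y\<rparr>)" for y
      using that Yc one_circ by (auto simp: subset_iff)
  qed
  then obtain y where y: "y \<in> ?Y" "y \<notin> ?F" and moved: "\<And>g. g \<in> ?P \<Longrightarrow> act g y \<otimes> inv y \<in> ?F"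
    using m_inv_consistent[OF Y] by auto
  have yc: "y \<in> carrier A" using y(1) Yc by blast
  interpret F: subgroup ?F A by (rule hypercentre_subgroup)
  \<comment> \<open>The stabiliser of the coset of \<open>y\<close> contains \<open>p_torsion A q\<close> for every prime \<open>q\<close>.\<close>
  define K where "K = {h \<in> carrier A. act h y \<otimes> inv y \<in> ?F}"
  have "subgroup K H"
  proof (rule circ.subgroupI)
    show "K \<subseteq> carrier H" unfolding K_def using carrier_circ by blast
    have "\<one> \<in> K" unfolding K_def using yc by simp
    then show "K \<noteq> {}" by blast
    show "inv\<^bsub>H\<^esub> h \<in> K" if "h \<in> K" for h
    proof -
      have hc: "h \<in> carrier A" and "act h y \<otimes> inv y \<in> ?F" using that unfolding K_def by auto
      then have "inv (act (inv\<^bsub>H\<^esub> h) (act h y \<otimes> inv y)) \<in> ?F"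
        using hypercentre_act[of "inv\<^bsub>H\<^esub> h"] by simp
      then have "act (inv\<^bsub>H\<^esub> h) y \<otimes> inv y \<in> ?F"
        using hc yc by (simp add: act_mult act_inv inv_mult_group)
      then show ?thesis unfolding K_def using hc by simp
    qed
    show "h \<otimes>\<^bsub>H\<^esub> k \<in> K" if "h \<in> K" "k \<in> K" for h k
    proof -
      have hc: "h \<in> carrier A" and kc: "k \<in> carrier A" and h: "act h y \<otimes> inv y \<in> ?F"
        and k: "act k y \<otimes> inv y \<in> ?F" using that unfolding K_def by auto
      have "act h (act k y \<otimes> inv y) \<otimes> (act h y \<otimes> inv y) \<in> ?F"
        using hypercentre_act[OF hc k] h by simp
      then have "act (h \<otimes>\<^bsub>H\<^esub> k) y \<otimes> inv y \<in> ?F"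
        using hc kc yc by (simp add: act_mult act_inv act_circ m_assoc inv_mult_cancel)
      then show ?thesis unfolding K_def using hc kc by simp
    qed
  qed
  then have "K = carrier H"
  proof (rule circ.subgroup_eq_carrier_if_contains_Sylow[rotated])
    fix q :: nat assume q: "prime q"
    have "p_torsion A q \<subseteq> K"
    proof
      fix b assume b: "b \<in> p_torsion A q"
      have bc: "b \<in> carrier A" using b unfolding p_torsion_def by blast
      show "b \<in> K"
      proof (cases "q = p")
        case True
        then show ?thesis using moved b bc unfolding K_def by simp
      next
        case False
        then have "act b y = y"
          using p_torsion_act_trivial[OF fin nilA nilH p q _ _ b, of y] y(1) by simp
        then show ?thesis using bc yc unfolding K_def by simp
      qed
    qed
    then show "\<exists>S. subgroup S H \<and> S \<subseteq> K \<and> card S = q ^ multiplicity q (order H)"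
      using tors(2,3)[OF q] carrier_circ by (auto simp: order_def)
  qed (use fin carrier_circ in simp)
  then have "act g y \<otimes> inv y \<in> ?F" if "g \<in> carrier A" for g
    using that carrier_circ unfolding K_def by blast
  then have "y \<in> hypercentre (Suc n)"
    using central_modD y(1) yc by (intro hypercentre_SucI) auto
  with y(2) show "\<exists>x \<in> hypercentre (Suc n). x \<notin> hypercentre n" by blast
qed

theorem brace_series_trivial_iff_circ_nilpotent:
  assumes "finite (carrier A)" and "nilpotent_group A"
  shows "(\<exists>n. brace_series n = {\<one>}) \<longleftrightarrow> nilpotent_group H"
  using hypercentre_exhausts_if_brace_series_trivial[OF assms]
    circ_nilpotent_if_hypercentre_exhausts
    hypercentre_exhausts_if_circ_nilpotent[OF assms]
    brace_series_trivial_if_hypercentre_exhausts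
  by blast

end

section \<open>Left semi-braces\<close>

lemma additive_group_simps:
  "carrier (additive_group B) = additive_part B"
  "x \<otimes>\<^bsub>additive_group B\<^esub> y = x \<boxplus>\<^bsub>B\<^esub> y"
  "\<one>\<^bsub>additive_group B\<^esub> = \<one>\<^bsub>B\<^esub>"
  unfolding additive_group_def by simp_all

context left_semi_brace
begin

lemma one_plus: "c \<in> carrier B \<Longrightarrow> \<one> \<boxplus> c = c"
  using mult_plus[of \<one> \<one> c] plus_left_cancel[of \<one> "\<one> \<boxplus> c" c] plus_closed by simp

lemma lambda_closed [simp]: "\<lbrakk>a \<in> carrier B; b \<in> carrier B\<rbrakk> \<Longrightarrow> lambda B a b \<in> carrier B"
  unfolding lambda_def by (simp add: plus_closed)

lemma mult_eq: "\<lbrakk>a \<in> carrier B; b \<in> carrier B\<rbrakk> \<Longrightarrow> a \<otimes> b = a \<boxplus> lambda B a b"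
  unfolding lambda_def using mult_plus[of a \<one> b] by (simp add: one_plus)

lemma lambda_plus:
  assumes "a \<in> carrier B" "b \<in> carrier B" "c \<in> carrier B"
  shows "lambda B a (b \<boxplus> c) = lambda B a b \<boxplus> lambda B a c"
  unfolding lambda_def using mult_plus[of a "inv a \<boxplus> b" c] assms
  by (simp add: plus_closed plus_assoc)

lemma lambda_mult:
  assumes a: "a \<in> carrier B" and b: "b \<in> carrier B" and c: "c \<in> carrier B"
  shows "lambda B (a \<otimes> b) c = lambda B a (lambda B b c)"
proof -
  have "(a \<otimes> b) \<boxplus> lambda B (a \<otimes> b) c = a \<otimes> (b \<otimes> c)"
    using a b c mult_eq[of "a \<otimes> b" c] by (simp add: m_assoc)
  also have "\<dots> = a \<boxplus> lambda B a (b \<boxplus> lambda B b c)"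
    using a b c mult_eq[of b c] mult_eq[of a "b \<otimes> c"] by (simp add: plus_closed)
  also have "\<dots> = (a \<otimes> b) \<boxplus> lambda B a (lambda B b c)"
    using a b c mult_eq[of a b] by (simp add: lambda_plus plus_assoc)
  finally show ?thesis using plus_left_cancel a b c by (meson lambda_closed m_closed)
qed

lemma lambda_one: "c \<in> carrier B \<Longrightarrow> lambda B \<one> c = c"
  unfolding lambda_def by (simp add: one_plus)

lemma plus_right_inverse: "a \<in> carrier B \<Longrightarrow> a \<boxplus> lambda B a (inv a) = \<one>"
  using mult_eq[of a "inv a"] by simp

lemma idempotents_carrier: "e \<in> idempotents B \<Longrightarrow> e \<in> carrier B"
  unfolding idempotents_def by blast

lemma idempotent_plus:
  assumes "e \<in> idempotents B" "x \<in> carrier B"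
  shows "e \<boxplus> x = x"
  using assms plus_assoc[of e e x] plus_left_cancel[of e "e \<boxplus> x" x] plus_closed
  unfolding idempotents_def by simp

lemma one_idempotent: "\<one> \<in> idempotents B"
  unfolding idempotents_def by (simp add: one_plus)

lemma lambda_idempotent:
  "\<lbrakk>a \<in> carrier B; e \<in> idempotents B\<rbrakk> \<Longrightarrow> lambda B a e \<in> idempotents B"
  unfolding idempotents_def using lambda_plus[of a e e] by simp

lemma lambda_of_idempotent:
  "\<lbrakk>e \<in> idempotents B; x \<in> carrier B\<rbrakk> \<Longrightarrow> lambda B e x = e \<otimes> x"
  using mult_eq[of e x] idempotent_plus[of e "lambda B e x"] idempotents_carrier by simp

lemma additive_part_iff: "x \<in> additive_part B \<longleftrightarrow> x \<in> carrier B \<and> x \<boxplus> \<one> = x"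
  unfolding additive_part_def using plus_closed plus_assoc[of _ \<one> \<one>] one_plus[of \<one>]
  by (auto intro: exI[of _ x])

lemma additive_part_carrier: "x \<in> additive_part B \<Longrightarrow> x \<in> carrier B"
  using additive_part_iff by blast

text \<open>
  The additive part is the stabiliser of the multiplicative identity under the action, because
  \<open>x = x \<otimes> \<one> = x \<boxplus> lambda B x \<one>\<close>; this makes it a multiplicative subgroup.
\<close>

lemma additive_part_iff_lambda: "x \<in> additive_part B \<longleftrightarrow> x \<in> carrier B \<and> lambda B x \<one> = \<one>"
proof -
  have "x \<boxplus> \<one> = x \<longleftrightarrow> lambda B x \<one> = \<one>" if x: "x \<in> carrier B"
    using mult_eq[of x \<one>] x plus_left_cancel[of x \<one> "lambda B x \<one>"] by auto
  then show ?thesis using additive_part_iff by blast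
qed

lemma one_additive_part: "\<one> \<in> additive_part B"
  unfolding additive_part_iff by (simp add: one_plus)

lemma plus_additive_part:
  "\<lbrakk>x \<in> carrier B; y \<in> additive_part B\<rbrakk> \<Longrightarrow> x \<boxplus> y \<in> additive_part B"
  unfolding additive_part_iff by (simp add: plus_assoc plus_closed)

lemma idempotent_in_additive_part:
  "\<lbrakk>e \<in> idempotents B; e \<in> additive_part B\<rbrakk> \<Longrightarrow> e = \<one>"
  using idempotent_plus[of e \<one>] additive_part_iff by simp

lemma right_inverse_additive_part:
  assumes a: "a \<in> carrier B"
  shows "lambda B a (inv a) \<in> additive_part B"
proof -
  let ?b = "lambda B a (inv a)"
  have "a \<boxplus> (?b \<boxplus> \<one>) = a \<boxplus> ?b"
    using a plus_right_inverse[OF a] plus_assoc[of a ?b \<one>] one_plus[of \<one>] by simp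
  then have "?b \<boxplus> \<one> = ?b" using a plus_left_cancel by (meson inv_closed lambda_closed one_closed plus_closed)
  then show ?thesis unfolding additive_part_iff using a by simp
qed

text \<open>
  With respect to \<open>\<boxplus>\<close> the right inverse of \<open>a\<close> is a left inverse only up to an idempotent.
\<close>

lemma right_inverse_plus_idempotent:
  assumes a: "a \<in> carrier B"
  shows "lambda B a (inv a) \<boxplus> a \<in> idempotents B"
proof -
  let ?b = "lambda B a (inv a)"
  have "(?b \<boxplus> a) \<boxplus> (?b \<boxplus> a) = ?b \<boxplus> ((a \<boxplus> ?b) \<boxplus> a)"
    using a by (simp add: plus_assoc plus_closed)
  also have "\<dots> = ?b \<boxplus> a" using a plus_right_inverse[OF a] by (simp add: one_plus)
  finally show ?thesis unfolding idempotents_def using a by (simp add: plus_closed)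
qed

lemma additive_group: "group (additive_group B)"
proof (rule groupI)
  fix x assume "x \<in> carrier (additive_group B)"
  then have x: "x \<in> additive_part B" by (simp add: additive_group_simps)
  let ?y = "lambda B x (inv x)"
  have xc: "x \<in> carrier B" using additive_part_carrier[OF x] .
  have y: "?y \<in> additive_part B" by (rule right_inverse_additive_part[OF xc])
  have "?y \<boxplus> x = \<one>"
    by (rule idempotent_in_additive_part[OF right_inverse_plus_idempotent[OF xc]
          plus_additive_part[OF additive_part_carrier[OF y] x]])
  then show "\<exists>y \<in> carrier (additive_group B). y \<otimes>\<^bsub>additive_group B\<^esub> x = \<one>\<^bsub>additive_group B\<^esub>"
    using y by (auto simp: additive_group_simps)
qed (simp_all add: additive_group_simps one_additive_part plus_additive_part additive_part_carrier
      plus_assoc one_plus)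

lemma lambda_additive_part:
  assumes "a \<in> additive_part B" "x \<in> additive_part B"
  shows "lambda B a x \<in> additive_part B"
  using assms lambda_plus[of a x \<one>] additive_part_iff additive_part_iff_lambda[of a] by simp

lemma additive_part_subgroup: "subgroup (additive_part B) B"
proof (rule subgroupI)
  show "additive_part B \<subseteq> carrier B" using additive_part_carrier by blast
  show "additive_part B \<noteq> {}" using one_additive_part by blast
  show "inv a \<in> additive_part B" if "a \<in> additive_part B" for a
    using that lambda_mult[of "inv a" a \<one>] lambda_one[of \<one>]
    unfolding additive_part_iff_lambda by simp
  show "a \<otimes> b \<in> additive_part B" if "a \<in> additive_part B" "b \<in> additive_part B" for a b
    using that lambda_mult[of a b \<one>] unfolding additive_part_iff_lambda by simp
qed

lemma skew_brace_additive_part: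
  "skew_brace (additive_group B) (B\<lparr>carrier := additive_part B\<rparr>) (lambda B)"
proof (intro skew_brace.intro skew_brace_axioms.intro additive_group
    subgroup_imp_group[OF additive_part_subgroup])
  show "lambda B g \<in> hom (additive_group B) (additive_group B)"
    if "g \<in> carrier (additive_group B)" for g
    using that lambda_additive_part additive_part_carrier lambda_plus
    by (auto simp: additive_group_simps hom_def)
  show "g \<otimes>\<^bsub>B\<lparr>carrier := additive_part B\<rparr>\<^esub> h = g \<otimes>\<^bsub>additive_group B\<^esub> lambda B g h"
    if "g \<in> carrier (additive_group B)" "h \<in> carrier (additive_group B)" for g h
    using that additive_part_carrier by (simp add: additive_group_simps mult_eq)
qed (simp_all add: additive_group_simps additive_part_carrier lambda_mult)

text \<open>
  Every element is the product of the idempotent \<open>lambda B b \<one>\<close> and an element that stabilises \<open>\<one>\<close>.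
\<close>

lemma idempotent_mult_additive_part:
  assumes b: "b \<in> carrier B"
  obtains e g where "e \<in> idempotents B" "g \<in> additive_part B" "b = e \<otimes> g"
proof -
  define e where "e = lambda B b \<one>"
  have e: "e \<in> idempotents B" unfolding e_def by (rule lambda_idempotent[OF b one_idempotent])
  have ec: "e \<in> carrier B" using idempotents_carrier[OF e] .
  have "lambda B e \<one> = e" using lambda_of_idempotent[OF e one_closed] ec by simp
  then have "lambda B (inv e \<otimes> b) \<one> = lambda B (inv e) (lambda B e \<one>)"
    using b ec lambda_mult[of "inv e" b \<one>] unfolding e_def by simp
  also have "\<dots> = \<one>" using ec lambda_mult[of "inv e" e \<one>] lambda_one[of \<one>] by simp
  finally have "inv e \<otimes> b \<in> additive_part B"
    unfolding additive_part_iff_lambda using b ec by simp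
  moreover have "b = e \<otimes> (inv e \<otimes> b)" using b ec by (simp add: inv_mult_cancel)
  ultimately show thesis using that e by blast
qed

lemma carrier_eq_plus_set: "carrier B = plus_set B (additive_part B) (idempotents B)"
proof
  show "plus_set B (additive_part B) (idempotents B) \<subseteq> carrier B"
    unfolding plus_set_def using additive_part_carrier idempotents_carrier plus_closed by blast
  show "carrier B \<subseteq> plus_set B (additive_part B) (idempotents B)"
  proof
    fix b assume b: "b \<in> carrier B"
    let ?c = "lambda B b (inv b)"
    have "(b \<boxplus> \<one>) \<boxplus> (?c \<boxplus> b) = (b \<boxplus> ?c) \<boxplus> b"
      using b by (simp add: plus_assoc plus_closed one_plus)
    then have "b = (b \<boxplus> \<one>) \<boxplus> (?c \<boxplus> b)"
      using b plus_right_inverse[OF b] by (simp add: one_plus)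
    then show "b \<in> plus_set B (additive_part B) (idempotents B)"
      unfolding plus_set_def
      using plus_additive_part[OF b one_additive_part] right_inverse_plus_idempotent[OF b] by blast
  qed
qed

lemma plus_set_idempotents_eq_iff:
  assumes "D \<subseteq> additive_part B" "\<one> \<in> D"
  shows "plus_set B D (idempotents B) = idempotents B \<longleftrightarrow> D = {\<one>}"
proof
  assume eq: "plus_set B D (idempotents B) = idempotents B"
  have "d = \<one>" if d: "d \<in> D" for d
  proof -
    have "d = d \<boxplus> \<one>" using d assms(1) additive_part_iff by auto
    then have "d \<in> idempotents B" using d one_idempotent eq unfolding plus_set_def by blast
    then show ?thesis using idempotent_in_additive_part d assms(1) by blast
  qed
  then show "D = {\<one>}" using assms(2) by blast
next
  assume "D = {\<one>}"
  then show "plus_set B D (idempotents B) = idempotents B"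
    unfolding plus_set_def using one_plus[OF idempotents_carrier] by force
qed

end

text \<open>
  The idempotents commute with the additive part under the multiplication, so that the
  multiplicative group is a direct product.
\<close>

locale central_semi_brace = left_semi_brace +
  assumes central: "idempotents B \<subseteq> centralizer B (additive_part B)"
begin

lemma idempotent_commute:
  "\<lbrakk>e \<in> idempotents B; g \<in> additive_part B\<rbrakk> \<Longrightarrow> e \<otimes> g = g \<otimes> e"
  using central unfolding centralizer_def by blast

sublocale brace: skew_brace "additive_group B" "B\<lparr>carrier := additive_part B\<rparr>" "lambda B"
  by (rule skew_brace_additive_part)

text \<open>
  The dot product of \<open>e \<otimes> g\<close> and \<open>d \<boxplus> f\<close>, for idempotents \<open>e\<close> and \<open>f\<close>, depends only on \<open>g\<close> and
  \<open>d\<close>: the element \<open>d \<boxplus> f\<close> has the same right inverse as \<open>d\<close>, and \<open>e\<close> acts trivially up to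
  adding an idempotent on the right, as \<open>lambda B e x = e \<otimes> x = x \<otimes> e = x \<boxplus> lambda B x e\<close>.
\<close>

lemma dot_eq:
  assumes e: "e \<in> idempotents B" and g: "g \<in> additive_part B"
    and d: "d \<in> additive_part B" and f: "f \<in> idempotents B"
  shows "dot B (e \<otimes> g) (d \<boxplus> f) = lambda B g d \<boxplus> inv\<^bsub>additive_group B\<^esub> d"
proof -
  have ec: "e \<in> carrier B" and gc: "g \<in> carrier B" and dc: "d \<in> carrier B" and fc: "f \<in> carrier B"
    using e g d f idempotents_carrier additive_part_carrier by blast+
  define n where "n = inv\<^bsub>additive_group B\<^esub> d"
  have n: "n \<in> additive_part B" and dn: "d \<boxplus> n = \<one>"
    using brace.inv_closed[of d] brace.r_inv[of d] d
    unfolding n_def by (simp_all add: additive_group_simps)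
  have nc: "n \<in> carrier B" using additive_part_carrier[OF n] .
  have dfc: "d \<boxplus> f \<in> carrier B" using dc fc plus_closed by simp
  define a where "a = e \<otimes> g"
  have ac: "a \<in> carrier B" unfolding a_def using ec gc by simp
  have inv_df: "lambda B (d \<boxplus> f) (inv (d \<boxplus> f)) = n"
  proof -
    have "(d \<boxplus> f) \<boxplus> n = \<one>"
      using plus_assoc[OF dc fc nc] idempotent_plus[OF f nc] dn by simp
    then show ?thesis
      using plus_right_inverse[OF dfc] plus_left_cancel[OF dfc _ nc] dfc by simp
  qed
  have x: "lambda B g d \<in> additive_part B" by (rule lambda_additive_part[OF g d])
  have xc: "lambda B g d \<in> carrier B" using additive_part_carrier[OF x] .
  have "lambda B a d = e \<otimes> lambda B g d"
    unfolding a_def lambda_mult[OF ec gc dc] by (rule lambda_of_idempotent[OF e xc])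
  also have "\<dots> = lambda B g d \<boxplus> lambda B (lambda B g d) e"
    using idempotent_commute[OF e x] mult_eq[OF xc ec] by simp
  finally have ad: "lambda B a d = lambda B g d \<boxplus> lambda B (lambda B g d) e" .
  have "dot B a (d \<boxplus> f) = lambda B a (inv a) \<boxplus> (a \<boxplus> lambda B a (d \<boxplus> f)) \<boxplus> n"
    unfolding dot_def inv_df mult_eq[OF ac dfc] ..
  also have "\<dots> = (lambda B a (inv a) \<boxplus> a) \<boxplus> (lambda B a (d \<boxplus> f) \<boxplus> n)"
    using ac dfc nc by (simp add: plus_assoc plus_closed)
  also have "\<dots> = lambda B a (d \<boxplus> f) \<boxplus> n"
    by (rule idempotent_plus[OF right_inverse_plus_idempotent[OF ac]])
      (use ac dfc nc in \<open>simp add: plus_closed\<close>)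
  also have "\<dots> = lambda B a d \<boxplus> (lambda B a f \<boxplus> n)"
    using ac dc fc nc by (simp add: lambda_plus plus_assoc)
  also have "\<dots> = lambda B a d \<boxplus> n"
    using idempotent_plus[OF lambda_idempotent[OF ac f] nc] by simp
  also have "\<dots> = lambda B g d \<boxplus> (lambda B (lambda B g d) e \<boxplus> n)"
    unfolding ad using xc ec nc by (simp add: plus_assoc)
  also have "\<dots> = lambda B g d \<boxplus> n"
    using idempotent_plus[OF lambda_idempotent[OF xc e] nc] by simp
  finally show ?thesis unfolding a_def n_def .
qed

lemma brace_series_subset: "brace.brace_series n \<subseteq> additive_part B"
proof (induction n)
  case 0
  show ?case by (simp add: additive_group_simps)
next
  case (Suc n)
  have "brace.brace_series (Suc n) \<subseteq> carrier (additive_group B)"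
    unfolding brace.brace_series.simps
    by (rule brace.generate_incl) (use Suc in \<open>auto simp: additive_group_simps
        intro!: plus_additive_part additive_part_carrier lambda_additive_part
        brace.inv_closed[unfolded additive_group_simps]\<close>)
  then show ?case by (simp add: additive_group_simps)
qed

lemma one_brace_series: "\<one> \<in> brace.brace_series n"
  using generate.one[of "additive_group B"] one_additive_part
  by (cases n) (auto simp: additive_group_simps)

lemma left_series_eq: "left_series B n = plus_set B (brace.brace_series n) (idempotents B)"
proof (induction n)
  case 0
  show ?case using carrier_eq_plus_set by (simp add: additive_group_simps)
next
  case (Suc n)
  let ?D = "brace.brace_series n"
  have "{dot B x y | x y. x \<in> carrier B \<and> y \<in> left_series B n} =
      {lambda B h x \<otimes>\<^bsub>additive_group B\<^esub> inv\<^bsub>additive_group B\<^esub> x | h x.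
        h \<in> carrier (additive_group B) \<and> x \<in> ?D}" (is "?L = ?R")
  proof
    show "?L \<subseteq> ?R"
    proof safe
      fix x y assume x: "x \<in> carrier B" and "y \<in> left_series B n"
      then obtain d f where d: "d \<in> ?D" and f: "f \<in> idempotents B" and y: "y = d \<boxplus> f"
        unfolding Suc plus_set_def by blast
      obtain e g where e: "e \<in> idempotents B" and g: "g \<in> additive_part B" and xeg: "x = e \<otimes> g"
        using idempotent_mult_additive_part[OF x] .
      have "dot B x y = lambda B g d \<boxplus> inv\<^bsub>additive_group B\<^esub> d"
        unfolding xeg y using dot_eq[OF e g _ f] d brace_series_subset by blast
      then show "\<exists>h x'. dot B x y = lambda B h x' \<otimes>\<^bsub>additive_group B\<^esub> inv\<^bsub>additive_group B\<^esub> x' \<and>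
          h \<in> carrier (additive_group B) \<and> x' \<in> ?D"
        using g d by (auto simp: additive_group_simps)
    qed
    show "?R \<subseteq> ?L"
    proof safe
      fix g d assume "g \<in> carrier (additive_group B)" and d: "d \<in> ?D"
      then have g: "g \<in> additive_part B" and d': "d \<in> additive_part B"
        using brace_series_subset by (auto simp: additive_group_simps)
      have "lambda B g d \<otimes>\<^bsub>additive_group B\<^esub> inv\<^bsub>additive_group B\<^esub> d = dot B (\<one> \<otimes> g) (d \<boxplus> \<one>)"
        using dot_eq[OF one_idempotent g d' one_idempotent] by (simp add: additive_group_simps)
      moreover have "d \<boxplus> \<one> \<in> left_series B n"
        unfolding Suc plus_set_def using d one_idempotent by blast
      ultimately show "\<exists>x y. lambda B g d \<otimes>\<^bsub>additive_group B\<^esub> inv\<^bsub>additive_group B\<^esub> d = dot B x y \<and>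
          x \<in> carrier B \<and> y \<in> left_series B n"
        using additive_part_carrier[OF g] by blast
    qed
  qed
  then show ?case by (simp add: dot_set_def)
qed

lemma left_nilpotent_iff:
  "left_nilpotent B \<longleftrightarrow> (\<exists>n. brace.brace_series n = {\<one>\<^bsub>additive_group B\<^esub>})"
  unfolding left_nilpotent_def left_series_eq
    plus_set_idempotents_eq_iff[OF brace_series_subset one_brace_series]
  by (simp add: additive_group_simps)

lemma nilpotent_group_iff:
  assumes nilE: "nilpotent_group (mult_idempotents B)"
  shows "nilpotent_group B \<longleftrightarrow> nilpotent_group (B\<lparr>carrier := additive_part B\<rparr>)"
proof
  let ?G = "B\<lparr>carrier := additive_part B\<rparr>"
  interpret E: group "mult_idempotents B" using nilE by (simp add: nilpotent_group_def)
  have hom: "group_hom ?G B (\<lambda>x. x)"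
    by unfold_locales (auto simp: hom_def additive_part_carrier)
  show "nilpotent_group ?G" if "nilpotent_group B"
    by (rule nilpotent_group_inj[OF hom _ that]) simp
  show "nilpotent_group B" if nilG: "nilpotent_group ?G"
  proof -
    let ?f = "\<lambda>(e, g). e \<otimes> g"
    interpret P: group "mult_idempotents B \<times>\<times> ?G"
      by (rule DirProd_group[OF E.is_group brace.circ.is_group])
    have "?f \<in> hom (mult_idempotents B \<times>\<times> ?G) B"
    proof (rule homI)
      fix x y
      assume "x \<in> carrier (mult_idempotents B \<times>\<times> ?G)" and "y \<in> carrier (mult_idempotents B \<times>\<times> ?G)"
      then obtain e g e' g' where x: "x = (e, g)" "e \<in> idempotents B" "g \<in> additive_part B"
        and y: "y = (e', g')" "e' \<in> idempotents B" "g' \<in> additive_part B"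
        by (auto simp: mult_idempotents_def)
      have "e \<in> carrier B" "g \<in> carrier B" "e' \<in> carrier B" "g' \<in> carrier B"
        using x y idempotents_carrier additive_part_carrier by blast+
      then have "e \<otimes> e' \<otimes> (g \<otimes> g') = e \<otimes> g \<otimes> (e' \<otimes> g')"
        using idempotent_commute[OF y(2) x(3)] by (metis m_assoc m_closed)
      then show "?f (x \<otimes>\<^bsub>mult_idempotents B \<times>\<times> ?G\<^esub> y) = ?f x \<otimes> ?f y"
        by (simp add: x y mult_idempotents_def)
    qed (auto simp: mult_idempotents_def idempotents_carrier additive_part_carrier)
    then have f_hom: "group_hom (mult_idempotents B \<times>\<times> ?G) B ?f" by unfold_locales
    have f_surj: "?f ` carrier (mult_idempotents B \<times>\<times> ?G) = carrier B"
    proof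
      show "carrier B \<subseteq> ?f ` carrier (mult_idempotents B \<times>\<times> ?G)"
      proof
        fix b assume "b \<in> carrier B"
        then obtain e g where "e \<in> idempotents B" "g \<in> additive_part B" "b = e \<otimes> g"
          by (rule idempotent_mult_additive_part)
        then show "b \<in> ?f ` carrier (mult_idempotents B \<times>\<times> ?G)"
          by (intro image_eqI[of _ _ "(e, g)"]) (auto simp: mult_idempotents_def)
      qed
    qed (auto simp: mult_idempotents_def idempotents_carrier additive_part_carrier)
    show ?thesis
      by (rule nilpotent_group_surj[OF f_hom f_surj nilpotent_group_DirProd[OF nilE nilG]])
  qed
qed

end

theorem proposition44:
  fixes B :: "('a, 'b) semi_brace_scheme"
  assumes "left_semi_brace B"
    and "finite (carrier (additive_group B))"
    and "nilpotent_group (additive_group B)"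
    and "nilpotent_group (mult_idempotents B)"
    and "idempotents B \<subseteq> centralizer B (additive_part B)"
  shows "left_nilpotent B \<longleftrightarrow> nilpotent_group B"
proof -
  interpret central_semi_brace B
    using assms(1,5) by (simp add: central_semi_brace_def central_semi_brace_axioms_def)
  show ?thesis
    using left_nilpotent_iff brace.brace_series_trivial_iff_circ_nilpotent[OF assms(2,3)]
      nilpotent_group_iff[OF assms(4)] by simp
qed

end
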